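(* Consider the magnetic geodesic flow of a metric $ds^2=g(z,\bar z)\,dz\,d\bar z$ with a real analytic magnetic field $B$ on a two-torus $M=\mathbb{R}^2/\Gamma$. Let $$F_2=a_2p_z^2+a_1p_z+a_{01}+a_{02}H+\bar a_1p_{\bar z}+\bar a_2p_{\bar z}^2$$ be a function on $T^*M$ quadratic in momenta, where $a_2,a_1$ are smooth complex-valued functions on $M$ with $a_2\not\equiv 0$, and $a_{01},a_{02}$ are smooth real-valued functions on $M$. If $F_2$ is a first integral of the flow on two different nonzero energy levels, $\{H=E_1\}$ and $\{H=E_2\}$ with $E_1\neq E_2$, $E_1,E_2>0$, then either the magnetic field vanishes everywhere or the magnetic geodesic flow admits a linear first integral.
   Context: Let $\Gamma\subset\mathbb{R}^2$ be a lattice, $z=x+iy$, and $M=\mathbb{R}^2/\Gamma$ with a smooth metric $ds^2=g(dx^2+dy^2)=g\,dz\,d\bar z$, $g>0$. On $T^*M$ with canonical momenta $p_x,p_y$ put $p_z=\frac12(p_x-ip_y)$, $p_{\bar z}=\frac12(p_x+ip_y)$. The magnetic field is a real-valued function $B$ on $M$ (representing the 2-form $B\,dx\wedge dy$). The magnetic Poisson bracket on (complex-valued) functions on $T^*M$ is determined by $\{z,p_z\}=\{\bar z,p_{\bar z}\}=1$, $\{z,p_{\bar z}\}=\{\bar z,p_z\}=0$, $\{z,\bar z\}=0$, $\{p_z,p_{\bar z}\}=iB$. The magnetic geodesic flow is the Hamiltonian flow $\dot f=\{f,H\}$ with $H=2g^{-1}p_zp_{\bar z}$. A function $F$ is a first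 integral on the energy level $\{H=E\}$ if $\{F,H\}=0$ on $\{H=E\}$, and a first integral of the flow if $\{F,H\}=0$ on $T^*M$. A linear first integral is a first integral of the form $ap_z+b+\bar a p_{\bar z}$, with $a$ a smooth complex-valued function on $M$ not identically zero and $b$ a smooth real-valued function on $M$. *)

theory Defs
  imports "HOL-Analysis.Analysis"
begin

text \<open>
  The plane \<open>\<real>\<^sup>2\<close> is identified with \<^typ>\<open>complex\<close> via \<open>z = x + iy\<close>; functions on the torus
  \<open>\<real>\<^sup>2/\<Gamma>\<close> are the \<open>\<Gamma>\<close>-periodic functions on \<^typ>\<open>complex\<close>.
\<close>

definition is_lattice :: "complex set \<Rightarrow> bool" where
  "is_lattice \<Gamma> \<longleftrightarrow> (\<exists>\<omega>\<^sub>1 \<omega>\<^sub>2. \<omega>\<^sub>1 \<noteq> \<omega>\<^sub>2 \<and> independent {\<omega>\<^sub>1, \<omega>\<^sub>2} \<and>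
     \<Gamma> = {of_int m * \<omega>\<^sub>1 + of_int n * \<omega>\<^sub>2 | m n. True})"

definition periodic :: "complex set \<Rightarrow> (complex \<Rightarrow> 'a) \<Rightarrow> bool" where
  "periodic \<Gamma> f \<longleftrightarrow> (\<forall>z. \<forall>\<gamma>\<in>\<Gamma>. f (z + \<gamma>) = f z)"

primrec C_k :: "nat \<Rightarrow> ('a::euclidean_space \<Rightarrow> 'b::real_normed_vector) \<Rightarrow> bool" where
  "C_k 0 f \<longleftrightarrow> continuous_on UNIV f"
| "C_k (Suc k) f \<longleftrightarrow>
     f differentiable_on UNIV \<and> (\<forall>v. C_k k (\<lambda>x. frechet_derivative f (at x) v))"

text \<open>Smoothness over the reals; on \<^typ>\<open>complex\<close> this does not mean holomorphic.\<close>

definition smooth :: "('a::euclidean_space \<Rightarrow> 'b::real_normed_vector) \<Rightarrow> bool" where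
  "smooth f \<longleftrightarrow> (\<forall>k. C_k k f)"

definition smooth_on_torus :: "complex set \<Rightarrow> (complex \<Rightarrow> 'b::real_normed_vector) \<Rightarrow> bool" where
  "smooth_on_torus \<Gamma> f \<longleftrightarrow> periodic \<Gamma> f \<and> smooth f"

text \<open>Real analyticity: near each point the function is the sum of a power series in \<open>x, y\<close>.\<close>

definition real_analytic :: "(complex \<Rightarrow> real) \<Rightarrow> bool" where
  "real_analytic f \<longleftrightarrow> (\<forall>z\<^sub>0. \<exists>c :: nat \<Rightarrow> nat \<Rightarrow> real. \<exists>r>0. \<forall>z\<in>ball z\<^sub>0 r.
     ((\<lambda>(m, n). c m n * Re (z - z\<^sub>0) ^ m * Im (z - z\<^sub>0) ^ n) has_sum f z) UNIV)"

text \<open>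
  A point \<open>(z, p\<^sub>x, p\<^sub>y)\<close> of \<open>phase\<close> stands for the covector \<open>p\<^sub>x dx + p\<^sub>y dy\<close> at \<open>z\<close>, so \<open>phase\<close> is the
  cotangent bundle of the universal cover of the torus.
\<close>

type_synonym phase = "complex \<times> real \<times> real"

definition q_z :: "phase \<Rightarrow> complex" where
  "q_z = (\<lambda>(z, p\<^sub>x, p\<^sub>y). z)"

definition q_zbar :: "phase \<Rightarrow> complex" where
  "q_zbar = (\<lambda>(z, p\<^sub>x, p\<^sub>y). cnj z)"

definition p_z :: "phase \<Rightarrow> complex" where
  "p_z = (\<lambda>(z, p\<^sub>x, p\<^sub>y). (of_real p\<^sub>x - \<i> * of_real p\<^sub>y) / 2)"

definition p_zbar :: "phase \<Rightarrow> complex" where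
  "p_zbar = (\<lambda>(z, p\<^sub>x, p\<^sub>y). (of_real p\<^sub>x + \<i> * of_real p\<^sub>y) / 2)"

text \<open>
  Derivations dual to the coordinates \<open>z, zbar, p_z, p_zbar\<close>. As \<open>p\<^sub>x = p_z + p_zbar\<close> and
  \<open>p\<^sub>y = i(p_z - p_zbar)\<close>, the momentum ones carry no factor \<open>1/2\<close>.
\<close>

definition d_z :: "(phase \<Rightarrow> complex) \<Rightarrow> phase \<Rightarrow> complex" where
  "d_z F q = (frechet_derivative F (at q) (1, 0, 0) - \<i> * frechet_derivative F (at q) (\<i>, 0, 0)) / 2"

definition d_zbar :: "(phase \<Rightarrow> complex) \<Rightarrow> phase \<Rightarrow> complex" where
  "d_zbar F q = (frechet_derivative F (at q) (1, 0, 0) + \<i> * frechet_derivative F (at q) (\<i>, 0, 0)) / 2"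

definition d_pz :: "(phase \<Rightarrow> complex) \<Rightarrow> phase \<Rightarrow> complex" where
  "d_pz F q = frechet_derivative F (at q) (0, 1, 0) + \<i> * frechet_derivative F (at q) (0, 0, 1)"

definition d_pzbar :: "(phase \<Rightarrow> complex) \<Rightarrow> phase \<Rightarrow> complex" where
  "d_pzbar F q = frechet_derivative F (at q) (0, 1, 0) - \<i> * frechet_derivative F (at q) (0, 0, 1)"

definition poisson :: "(complex \<Rightarrow> real) \<Rightarrow> (phase \<Rightarrow> complex) \<Rightarrow> (phase \<Rightarrow> complex) \<Rightarrow> phase \<Rightarrow> complex" where
  "poisson B F G q =
     d_z F q * d_pz G q - d_pz F q * d_z G q
   + d_zbar F q * d_pzbar G q - d_pzbar F q * d_zbar G q
   + \<i> * of_real (B (q_z q)) * (d_pz F q * d_pzbar G q - d_pzbar F q * d_pz G q)"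

text \<open>
  The bracket is the biderivation determined by its values on the coordinate functions.
\<close>

lemma has_derivative_coords:
  "(q_z has_derivative q_z) (at q)"
  "(q_zbar has_derivative q_zbar) (at q)"
  "(p_z has_derivative p_z) (at q)"
  "(p_zbar has_derivative p_zbar) (at q)"
  unfolding q_z_def q_zbar_def p_z_def p_zbar_def case_prod_unfold
  by (auto intro!: derivative_eq_intros)

lemmas frechet_derivative_coords =
  has_derivative_coords[THEN frechet_derivative_at, symmetric]

lemma poisson_coords:
  "poisson B q_z p_z q = 1" "poisson B q_zbar p_zbar q = 1"
  "poisson B q_z p_zbar q = 0" "poisson B q_zbar p_z q = 0"
  "poisson B q_z q_zbar q = 0"
  "poisson B p_z p_zbar q = \<i> * of_real (B (q_z q))"
  by (simp_all add: poisson_def d_z_def d_zbar_def d_pz_def d_pzbar_def frechet_derivative_coords,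
      simp_all add: q_z_def q_zbar_def p_z_def p_zbar_def case_prod_unfold)

lemma poisson_antisym: "poisson B G F q = - poisson B F G q"
  by (simp add: poisson_def algebra_simps)

lemma poisson_add:
  assumes "F differentiable at q" "G differentiable at q"
  shows "poisson B (\<lambda>q. F q + G q) K q = poisson B F K q + poisson B G K q"
proof -
  have "((\<lambda>q. F q + G q) has_derivative
      (\<lambda>v. frechet_derivative F (at q) v + frechet_derivative G (at q) v)) (at q)"
    using assms by (intro has_derivative_add) (simp_all add: frechet_derivative_works)
  note frechet_derivative_at[OF this, symmetric]
  then show ?thesis
    by (simp add: poisson_def d_z_def d_zbar_def d_pz_def d_pzbar_def field_simps)
qed

lemma poisson_mult:
  assumes "F differentiable at q" "G differentiable at q"
  shows "poisson B (\<lambda>q. F q * G q) K q = F q * poisson B G K q + poisson B F K q * G q"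
proof -
  have "((\<lambda>q. F q * G q) has_derivative
      (\<lambda>v. F q * frechet_derivative G (at q) v + frechet_derivative F (at q) v * G q)) (at q)"
    using assms by (intro has_derivative_mult) (simp_all add: frechet_derivative_works)
  note frechet_derivative_at[OF this, symmetric]
  then show ?thesis
    by (simp add: poisson_def d_z_def d_zbar_def d_pz_def d_pzbar_def field_simps)
qed

definition hamiltonian :: "(complex \<Rightarrow> real) \<Rightarrow> phase \<Rightarrow> complex" where
  "hamiltonian g q = 2 * inverse (of_real (g (q_z q))) * p_z q * p_zbar q"

definition first_integral_on_level ::
    "(complex \<Rightarrow> real) \<Rightarrow> (complex \<Rightarrow> real) \<Rightarrow> real \<Rightarrow> (phase \<Rightarrow> complex) \<Rightarrow> bool" where
  "first_integral_on_level g B E F \<longleftrightarrow>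
     (\<forall>q. hamiltonian g q = of_real E \<longrightarrow> poisson B F (hamiltonian g) q = 0)"

definition first_integral ::
    "(complex \<Rightarrow> real) \<Rightarrow> (complex \<Rightarrow> real) \<Rightarrow> (phase \<Rightarrow> complex) \<Rightarrow> bool" where
  "first_integral g B F \<longleftrightarrow> (\<forall>q. poisson B F (hamiltonian g) q = 0)"

definition linear_fn :: "(complex \<Rightarrow> complex) \<Rightarrow> (complex \<Rightarrow> real) \<Rightarrow> phase \<Rightarrow> complex" where
  "linear_fn a b q = a (q_z q) * p_z q + of_real (b (q_z q)) + cnj (a (q_z q)) * p_zbar q"

definition quadratic_fn :: "(complex \<Rightarrow> real) \<Rightarrow> (complex \<Rightarrow> complex) \<Rightarrow> (complex \<Rightarrow> complex) \<Rightarrow>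
    (complex \<Rightarrow> real) \<Rightarrow> (complex \<Rightarrow> real) \<Rightarrow> phase \<Rightarrow> complex" where
  "quadratic_fn g a\<^sub>2 a\<^sub>1 a\<^sub>0\<^sub>1 a\<^sub>0\<^sub>2 q =
     a\<^sub>2 (q_z q) * p_z q ^ 2 + a\<^sub>1 (q_z q) * p_z q + of_real (a\<^sub>0\<^sub>1 (q_z q))
   + of_real (a\<^sub>0\<^sub>2 (q_z q)) * hamiltonian g q
   + cnj (a\<^sub>1 (q_z q)) * p_zbar q + cnj (a\<^sub>2 (q_z q)) * p_zbar q ^ 2"

definition admits_linear_integral ::
    "complex set \<Rightarrow> (complex \<Rightarrow> real) \<Rightarrow> (complex \<Rightarrow> real) \<Rightarrow> bool" where
  "admits_linear_integral \<Gamma> g B \<longleftrightarrow>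
     (\<exists>a b. smooth_on_torus \<Gamma> a \<and> (\<exists>z. a z \<noteq> 0) \<and> smooth_on_torus \<Gamma> b \<and>
        first_integral g B (linear_fn a b))"

end

theory Submission
  imports Defs "HOL-Complex_Analysis.Complex_Analysis"
begin

text \<open>
  Comparing Fourier coefficients in the momentum angle on the two energy levels, the equation
  \<open>{F\<^sub>2, H} = 0\<close> becomes: \<open>a\<^sub>2\<close> is holomorphic, hence a nonzero constant \<open>s\<^sup>2\<close>; \<open>w = a\<^sub>1/s\<close> satisfies
  \<open>\<partial>w/\<partial>zbar = -2iBs\<close>; \<open>w\<^sup>2 - 4a\<^sub>0\<^sub>1\<close> is holomorphic, hence constant; and \<open>Re \<partial>(g a\<^sub>1)/\<partial>z = 0\<close>.
  Writing \<open>w = u + iv\<close> and \<open>X, Y\<close> for the derivatives in the directions \<open>s, is\<close>, this says that \<open>uv\<close> is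
  constant, \<open>Xu = Yv\<close>, \<open>Yu + Xv = -4|s|\<^sup>2 B\<close> and \<open>X(gu) + Y(gv) = 0\<close>.

  If \<open>uv = c \<noteq> 0\<close>, then \<open>u\<close> solves the Burgers-type equation \<open>Xu + (c/u\<^sup>2) Yu = 0\<close> on the whole plane, so
  it is constant along straight characteristics; these intersect unless \<open>u\<^sup>2\<close> is constant, and \<open>B = 0\<close>.
  If \<open>uv = 0\<close>, analyticity makes \<open>B\<close> invariant in direction \<open>s\<close> when \<open>u\<close> does not vanish identically, and
  in direction \<open>is\<close> when \<open>v\<close> does not. If both happen, \<open>B\<close> is constant and vanishes at a maximum of \<open>u\<^sup>2\<close>.
  If \<open>v = 0\<close>, then either \<open>u\<close> vanishes on an open set, whence \<open>B = 0\<close>, or \<open>Xg = 0\<close> and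
  \<open>s p_z + u/2 + conj(s) p_zbar\<close> is a linear integral; the case \<open>u = 0\<close> is symmetric.
\<close>

subsection \<open>Real analytic and periodic functions on the plane\<close>

text \<open>A series with a nonzero coefficient has no zeros in a punctured neighbourhood of its
  centre, so accumulation of zeros forces all coefficients to vanish. The zero set enters through
  its interior, so that the conclusion makes this interior closed.\<close>

lemma powser_zero_near:
  fixes f :: "real \<Rightarrow> real"
  assumes "r > 0" and sums: "\<And>s. \<bar>s - s0\<bar> < r \<Longrightarrow> (\<lambda>k. c k * (s - s0) ^ k) sums f s"
    and acc: "s0 \<in> closure (interior {s. f s = 0})"
  shows "s0 \<in> interior {s. f s = 0}"
proof -
  \<comment> \<open>Otherwise the ball would meet the interior of the zero set in exactly
    \<open>{s0}\<close>, an open singleton in the real line.\<close>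
  have no_punct: False if "d > 0" and nz: "\<And>s. s \<noteq> s0 \<Longrightarrow> \<bar>s - s0\<bar> < d \<Longrightarrow> f s \<noteq> 0" for d
  proof -
    let ?W = "ball s0 d \<inter> interior {s. f s = 0}"
    have "?W \<noteq> {}"
      using acc \<open>d > 0\<close> by (metis centre_in_ball disjoint_iff open_ball open_Int_closure_eq_empty)
    moreover have "?W \<subseteq> {s0}"
      using nz interior_subset by (fastforce simp: dist_real_def abs_minus_commute)
    ultimately have "?W = {s0}" by auto
    then show False
      by (metis open_Int open_ball open_interior not_open_singleton)
  qed
  have "c k = 0" for k
  proof (rule ccontr)
    assume "c k \<noteq> 0"
    show False
    \<comment> \<open>The isolated-zero theorem needs the value 0 at the centre; if
      \<open>c 0\<close> is nonzero, the limit at the centre already excludes nearby zeros.\<close>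
    proof (cases "c 0 = 0")
      case True
      then have "k > 0" "f s0 = 0"
        using \<open>c k \<noteq> 0\<close> sums[of s0] \<open>r > 0\<close> sums_unique2[OF powser_sums_zero]
        by (auto simp: gr0_conv_Suc) (metis not0_implies_Suc)
      obtain d where "d > 0" "\<And>s. s \<in> cball s0 d - {s0} \<Longrightarrow> f s \<noteq> 0"
        using powser_0_nonzero[where f = f and a = c and \<xi> = s0 and m = k, OF \<open>r > 0\<close> _ \<open>f s0 = 0\<close> \<open>c k \<noteq> 0\<close> \<open>k > 0\<close>] sums
        by auto
      then show False
        using no_punct[of d] by (auto simp: dist_real_def abs_minus_commute)
    next
      case False
      have "((\<lambda>h. f (s0 + h)) \<longlongrightarrow> c 0) (at 0)"
        using powser_limit_0[where f = "\<lambda>h. f (s0 + h)" and a = c, OF \<open>r > 0\<close>] sums[of "s0 + _"] by simp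
      then have "\<forall>\<^sub>F h in at 0. f (s0 + h) \<noteq> 0"
        using False by (rule tendsto_imp_eventually_ne)
      then obtain d where "d > 0" "\<And>h. h \<noteq> 0 \<Longrightarrow> \<bar>h\<bar> < d \<Longrightarrow> f (s0 + h) \<noteq> 0"
        by (auto simp: eventually_at dist_real_def)
      from this(1) this(2)[of "_ - s0"] show False
        using no_punct[of d] by auto
    qed
  qed
  then have "f s = 0" if "\<bar>s - s0\<bar> < r" for s
    using sums[OF that] by (simp add: sums_iff)
  then have "ball s0 r \<subseteq> {s. f s = 0}"
    by (auto simp: dist_real_def abs_minus_commute)
  then show ?thesis
    using \<open>r > 0\<close> by (meson centre_in_ball interior_maximal open_ball subset_iff)
qed

text \<open>The interior of the zero set is open, nonempty and, by \<open>powser_zero_near\<close>,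
  closed; the line is connected.\<close>

lemma analytic_identity_real:
  fixes f :: "real \<Rightarrow> real"
  assumes ser: "\<And>s0. \<exists>c. \<exists>r>0. \<forall>s. \<bar>s - s0\<bar> < r \<longrightarrow> (\<lambda>k. c k * (s - s0) ^ k) sums f s"
    and zero: "interior {s. f s = 0} \<noteq> {}"
  shows "f s = 0"
proof -
  have "closure (interior {s. f s = 0}) \<subseteq> interior {s. f s = 0}"
  proof
    fix s0 assume s0: "s0 \<in> closure (interior {s. f s = 0})"
    obtain c r where "r > 0" "\<And>s. \<bar>s - s0\<bar> < r \<Longrightarrow> (\<lambda>k. c k * (s - s0) ^ k) sums f s"
      using ser by blast
    then show "s0 \<in> interior {s. f s = 0}"
      using s0 by (rule powser_zero_near)
  qed
  then have "closed (interior {s. f s = 0})"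
    using closure_subset_eq by blast
  then have "interior {s. f s = 0} = UNIV"
    using zero by (metis clopen open_interior)
  then show ?thesis
    using interior_subset by blast
qed

section \<open>Identity theorem in two variables by restriction to lines\<close>

lemma real_analyticE:
  assumes "real_analytic f"
  obtains c r where "r > 0" and "\<And>z. z \<in> ball z0 r \<Longrightarrow>
     ((\<lambda>(m, n). c m n * Re (z - z0) ^ m * Im (z - z0) ^ n) has_sum f z) UNIV"
proof -
  have "\<exists>c r. r > 0 \<and> (\<forall>z\<in>ball z0 r.
      ((\<lambda>(m, n). c m n * Re (z - z0) ^ m * Im (z - z0) ^ n) has_sum f z) UNIV)"
    using assms unfolding real_analytic_def by (rule spec)
  then show thesis
    by (elim exE conjE) (rule that, assumption, erule bspec)
qed

text \<open>Along a line both coordinates are multiples of \<open>s - s0\<close>, so the double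
  series becomes a power series once terms of equal total degree are collected; unconditional
  summation in \<open>has_sum\<close> permits this regrouping.\<close>

lemma real_analytic_line:
  assumes "real_analytic f"
  shows "\<exists>c. \<exists>r>0. \<forall>s. \<bar>s - s0\<bar> < r \<longrightarrow> (\<lambda>k. c k * (s - s0) ^ k) sums f (z + s *\<^sub>R w)"
proof -
  define z0 where "z0 = z + s0 *\<^sub>R w"
  obtain c r where "r > 0" and c: "\<And>z. z \<in> ball z0 r \<Longrightarrow>
     ((\<lambda>(m, n). c m n * Re (z - z0) ^ m * Im (z - z0) ^ n) has_sum f z) (UNIV :: (nat \<times> nat) set)"
    using real_analyticE[OF assms] by blast
  define C where "C k = (\<Sum>i\<le>k. c i (k - i) * Re w ^ i * Im w ^ (k - i))" for k
  \<comment> \<open>The summand 1 covers the direction \<open>w = 0\<close>, where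
    \<open>r / norm w\<close> would be 0 by convention.\<close>
  have "(\<lambda>k. C k * (s - s0) ^ k) sums f (z + s *\<^sub>R w)" if "\<bar>s - s0\<bar> < r / (norm w + 1)" for s
  proof (rule has_sum_imp_sums, rule has_sum_SigmaD)
    have eq: "z + s *\<^sub>R w - z0 = (s - s0) *\<^sub>R w"
      by (simp add: z0_def algebra_simps)
    have "\<bar>s - s0\<bar> * (norm w + 1) < r"
      using that by (simp add: pos_less_divide_eq add_nonneg_pos)
    moreover have "\<bar>s - s0\<bar> * norm w \<le> \<bar>s - s0\<bar> * (norm w + 1)"
      by (intro mult_left_mono) auto
    ultimately have "norm ((s - s0) *\<^sub>R w) < r"
      by simp
    then have "z + s *\<^sub>R w \<in> ball z0 r"
      using eq by (metis dist_commute dist_norm mem_ball)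
    from c[OF this] have "((\<lambda>(m, n). c m n * ((s - s0) * Re w) ^ m * ((s - s0) * Im w) ^ n)
        has_sum f (z + s *\<^sub>R w)) UNIV"
      unfolding eq by simp
    \<comment> \<open>The exponent pair \<open>(m, n)\<close> is sent to \<open>(m + n, m)\<close>:
      total degree first, then the exponent of the real part.\<close>
    then show "((\<lambda>(k, i). c i (k - i) * Re w ^ i * Im w ^ (k - i) * (s - s0) ^ k)
        has_sum f (z + s *\<^sub>R w)) (Sigma UNIV (\<lambda>k. {..k}))"
      by (rule iffD1[OF has_sum_reindex_bij_witness[where i = "\<lambda>(k, i). (i, k - i)" and
            j = "\<lambda>(m, n). (m + n, m)"], rotated -1])
         (auto simp: power_mult_distrib power_add)
    show "((\<lambda>i. case (k, i) of (k, i) \<Rightarrow> c i (k - i) * Re w ^ i * Im w ^ (k - i) * (s - s0) ^ k)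
        has_sum C k * (s - s0) ^ k) {..k}" for k
      by (intro has_sum_finiteI) (auto simp: C_def sum_distrib_right)
  qed
  moreover have "r / (norm w + 1) > 0"
    using \<open>r > 0\<close> by (simp add: add_nonneg_pos)
  ultimately show ?thesis by blast
qed

text \<open>Restricting to the line from a point of \<open>U\<close> to \<open>z\<close> reduces the
  claim to one variable: the parameters mapped into \<open>U\<close> form an open set of zeros
  around 0.\<close>

lemma real_analytic_identity:
  assumes "real_analytic f" and "open U" "U \<noteq> {}" and "\<And>z. z \<in> U \<Longrightarrow> f z = 0"
  shows "f z = 0"
proof -
  obtain z0 where "z0 \<in> U" using assms by blast
  let ?h = "\<lambda>s::real. z0 + s *\<^sub>R (z - z0)"
  have "open (?h -` U)"
    by (intro open_vimage \<open>open U\<close> continuous_intros)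
  moreover have "0 \<in> ?h -` U" "?h -` U \<subseteq> {s. f (?h s) = 0}"
    using \<open>z0 \<in> U\<close> assms(4) by auto
  ultimately have "interior {s. f (?h s) = 0} \<noteq> {}"
    by (metis empty_iff interior_maximal subsetD)
  then have "f (?h 1) = 0"
    using analytic_identity_real[where f = "\<lambda>s. f (?h s)"] real_analytic_line[OF assms(1)] by blast
  then show ?thesis by simp
qed

text \<open>Together with \<open>real_analytic_diff\<close> this makes
  \<open>B (z + t) - B z\<close> analytic, so that an invariance of \<open>B\<close> found on a ball
  extends to the plane.\<close>

lemma real_analytic_translate:
  assumes "real_analytic f"
  shows "real_analytic (\<lambda>z. f (z + t))"
  unfolding real_analytic_def
proof
  fix z0
  obtain c r where "r > 0" and c: "\<And>z. z \<in> ball (z0 + t) r \<Longrightarrow>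
     ((\<lambda>(m, n). c m n * Re (z - (z0 + t)) ^ m * Im (z - (z0 + t)) ^ n) has_sum f z) UNIV"
    using real_analyticE[OF assms] by blast
  have "((\<lambda>(m, n). c m n * Re (z - z0) ^ m * Im (z - z0) ^ n) has_sum f (z + t)) UNIV"
    if "z \<in> ball z0 r" for z
    using c[of "z + t"] that by simp
  then show "\<exists>c. \<exists>r>0. \<forall>z\<in>ball z0 r.
      ((\<lambda>(m, n). c m n * Re (z - z0) ^ m * Im (z - z0) ^ n) has_sum f (z + t)) UNIV"
    using \<open>r > 0\<close> by blast
qed

lemma real_analytic_diff:
  assumes "real_analytic f" "real_analytic g"
  shows "real_analytic (\<lambda>z. f z - g z)"
  unfolding real_analytic_def
proof
  fix z0
  obtain c r where "r > 0" and c: "\<And>z. z \<in> ball z0 r \<Longrightarrow>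
     ((\<lambda>(m, n). c m n * Re (z - z0) ^ m * Im (z - z0) ^ n) has_sum f z) UNIV"
    using real_analyticE[OF assms(1)] by blast
  obtain d s where "s > 0" and d: "\<And>z. z \<in> ball z0 s \<Longrightarrow>
     ((\<lambda>(m, n). d m n * Re (z - z0) ^ m * Im (z - z0) ^ n) has_sum g z) UNIV"
    using real_analyticE[OF assms(2)] by blast
  have "((\<lambda>(m, n). (c m n - d m n) * Re (z - z0) ^ m * Im (z - z0) ^ n) has_sum f z - g z) UNIV"
    if "z \<in> ball z0 (min r s)" for z
    using has_sum_add[OF c has_sum_uminusI[OF d], of z] that
    by (simp only: case_prod_unfold left_diff_distrib) simp
  then show "\<exists>c. \<exists>r>0. \<forall>z\<in>ball z0 r.
      ((\<lambda>(m, n). c m n * Re (z - z0) ^ m * Im (z - z0) ^ n) has_sum f z - g z) UNIV"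
    using \<open>r > 0\<close> \<open>s > 0\<close> by (intro exI[of _ "\<lambda>m n. c m n - d m n"] exI[of _ "min r s"]) simp
qed

text \<open>All values are already taken on a closed period parallelogram, since two independent
  vectors span the plane. This replaces compactness of the torus wherever bounds or maxima are
  needed.\<close>

lemma periodic_range_compact:
  fixes f :: "complex \<Rightarrow> 'a::topological_space"
  assumes "is_lattice \<Gamma>" "periodic \<Gamma> f" "continuous_on UNIV f"
  shows "compact (range f)"
proof -
  obtain w1 w2 where w: "w1 \<noteq> w2" "independent {w1, w2}"
      and \<Gamma>: "\<Gamma> = {of_int m * w1 + of_int n * w2 | m n. True}"
    using assms(1) unfolding is_lattice_def by blast
  have "card {w1, w2} = DIM(complex)"
    using w(1) by simp
  then have span: "span {w1, w2} = UNIV"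
    using card_eq_dim[of "{w1, w2}" UNIV] w(2) by (auto simp: dim_UNIV)
  let ?P = "(\<lambda>(s::real, t::real). s *\<^sub>R w1 + t *\<^sub>R w2) ` ({0..1} \<times> {0..1})"
  have "compact ?P"
    unfolding case_prod_unfold
    by (intro compact_continuous_image compact_Times compact_Icc continuous_intros)
  then have "compact (f ` ?P)"
    by (rule compact_continuous_image[OF continuous_on_subset[OF assms(3)], rotated]) simp
  moreover have "range f \<subseteq> f ` ?P"
  proof
    fix y assume "y \<in> range f"
    then obtain z where y: "y = f z" by blast
    have "z \<in> span {w1, w2}"
      using span by simp
    then obtain s t where z: "z = s *\<^sub>R w1 + t *\<^sub>R w2"
      unfolding span_insert by (auto simp: span_singleton algebra_simps)
    define p where "p = frac s *\<^sub>R w1 + frac t *\<^sub>R w2"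
    have "z = p + (of_int \<lfloor>s\<rfloor> * w1 + of_int \<lfloor>t\<rfloor> * w2)"
      by (simp add: z p_def frac_def scaleR_conv_of_real algebra_simps)
    then have "f z = f p"
      using assms(2) unfolding periodic_def \<Gamma> by blast
    moreover have "p \<in> ?P"
      unfolding p_def by (rule image_eqI[of _ _ "(frac s, frac t)"])
        (auto simp: frac_lt_1 less_imp_le)
    ultimately show "y \<in> f ` ?P"
      using y by blast
  qed
  moreover have "f ` ?P \<subseteq> range f" by blast
  ultimately show ?thesis
    by (simp add: subset_antisym)
qed

subsection \<open>Wirtinger derivatives and the Poisson bracket\<close>

definition dz :: "(complex \<Rightarrow> complex) \<Rightarrow> complex \<Rightarrow> complex" where
  "dz f z = (frechet_derivative f (at z) 1 - \<i> * frechet_derivative f (at z) \<i>) / 2"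

definition dzbar :: "(complex \<Rightarrow> complex) \<Rightarrow> complex \<Rightarrow> complex" where
  "dzbar f z = (frechet_derivative f (at z) 1 + \<i> * frechet_derivative f (at z) \<i>) / 2"

lemma has_derivative_wirtinger:
  assumes "f differentiable at z"
  shows "(f has_derivative (\<lambda>h. dz f z * h + dzbar f z * cnj h)) (at z)"
proof -
  let ?D = "frechet_derivative f (at z)"
  have D: "(f has_derivative ?D) (at z)"
    using assms frechet_derivative_works by blast
  interpret linear ?D
    by (rule has_derivative_linear[OF D])
  have "?D h = dz f z * h + dzbar f z * cnj h" for h
  proof -
    have "h = Re h *\<^sub>R 1 + Im h *\<^sub>R \<i>"
      by (simp add: complex_eq_iff)
    then have "?D h = Re h *\<^sub>R ?D 1 + Im h *\<^sub>R ?D \<i>"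
      by (metis add scale)
    then show ?thesis
      by (simp add: dz_def dzbar_def complex_eq_iff field_simps)
  qed
  then show ?thesis
    using D by presburger
qed

text \<open>The values of a real-linear map at 1 and at the imaginary unit determine the
  coefficients of \<open>h\<close> and \<open>cnj h\<close>. Wirtinger derivatives are computed
  below by exhibiting a derivative of this shape.\<close>

lemma wirtinger_unique:
  assumes "(f has_derivative (\<lambda>h. a * h + b * cnj h)) (at z)"
  shows "dz f z = a" "dzbar f z = b"
  using frechet_derivative_at[OF assms, symmetric]
  by (simp_all add: dz_def dzbar_def field_simps)

lemma wirtinger_cnj:
  assumes "f differentiable at z"
  shows "dz (\<lambda>z. cnj (f z)) z = cnj (dzbar f z)" "dzbar (\<lambda>z. cnj (f z)) z = cnj (dz f z)"
proof -
  have "((\<lambda>z. cnj (f z)) has_derivative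
      (\<lambda>h. cnj (dzbar f z) * h + cnj (dz f z) * cnj h)) (at z)"
    using has_derivative_cnj[OF has_derivative_wirtinger[OF assms]] by (simp add: add.commute)
  then show "dz (\<lambda>z. cnj (f z)) z = cnj (dzbar f z)" "dzbar (\<lambda>z. cnj (f z)) z = cnj (dz f z)"
    by (rule wirtinger_unique)+
qed

lemma differentiable_bounded_linear:
  assumes "bounded_linear L" "f differentiable F"
  shows "(\<lambda>x. L (f x)) differentiable F"
  using assms bounded_linear.has_derivative unfolding differentiable_def by blast

lemmas differentiable_of_real = differentiable_bounded_linear[OF bounded_linear_of_real]
lemmas differentiable_cnj = differentiable_bounded_linear[OF bounded_linear_cnj]

lemma wirtinger_of_real:
  assumes "f differentiable at z"
  shows "dz (\<lambda>z. of_real (f z)) z = cnj (dzbar (\<lambda>z. of_real (f z)) z)"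
  using wirtinger_cnj(1)[OF differentiable_of_real[OF assms]] by simp

lemma frechet_derivative_lift:
  assumes "f differentiable at (q_z q)"
  shows "frechet_derivative (\<lambda>q. f (q_z q)) (at q) v = frechet_derivative f (at (q_z q)) (q_z v)"
proof -
  have "((\<lambda>q. f (q_z q)) has_derivative (\<lambda>v. frechet_derivative f (at (q_z q)) (q_z v))) (at q)"
    using has_derivative_compose[OF has_derivative_coords(1)] assms frechet_derivative_works by blast
  from frechet_derivative_at[OF this] show ?thesis
    by metis
qed

lemma differentiable_lift:
  assumes "f differentiable at (q_z q)"
  shows "(\<lambda>q. f (q_z q)) differentiable at q"
  using has_derivative_compose[OF has_derivative_coords(1)] assms
  unfolding differentiable_def by blast

lemma differentiable_p: "p_z differentiable at q" "p_zbar differentiable at q"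
  using has_derivative_coords unfolding differentiable_def by blast+

text \<open>Momentum derivatives of a function of the base point vanish, which also removes the
  magnetic term.\<close>

lemma poisson_lift:
  assumes "f differentiable at (q_z q)"
  shows "poisson B (\<lambda>q. f (q_z q)) K q = dz f (q_z q) * d_pz K q + dzbar f (q_z q) * d_pzbar K q"
proof -
  have "linear (frechet_derivative f (at (q_z q)))"
    using assms by (rule linear_frechet_derivative)
  then have "frechet_derivative f (at (q_z q)) 0 = 0"
    by (rule linear_0)
  then show ?thesis
    by (simp add: poisson_def d_z_def d_zbar_def d_pz_def d_pzbar_def
        frechet_derivative_lift[OF assms] dz_def dzbar_def)
      (simp add: q_z_def)
qed

lemma poisson_p:
  "poisson B p_z K q = - d_z K q + \<i> * of_real (B (q_z q)) * d_pzbar K q"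
  "poisson B p_zbar K q = - d_zbar K q - \<i> * of_real (B (q_z q)) * d_pz K q"
  by (simp_all add: poisson_def d_z_def[of p_z] d_zbar_def[of p_z] d_pz_def[of p_z] d_pzbar_def[of p_z]
      d_z_def[of p_zbar] d_zbar_def[of p_zbar] d_pz_def[of p_zbar] d_pzbar_def[of p_zbar]
      frechet_derivative_coords)
    (simp_all add: p_z_def p_zbar_def)

lemma hamiltonian_derivatives:
  assumes "g differentiable at (q_z q)" "g (q_z q) \<noteq> 0"
  defines "G \<equiv> complex_of_real (g (q_z q))"
  shows "d_pz (hamiltonian g) q = 2 / G * p_zbar q"
    and "d_pzbar (hamiltonian g) q = 2 / G * p_z q"
    and "d_z (hamiltonian g) q = - 2 * dz (\<lambda>z. of_real (g z)) (q_z q) / G\<^sup>2 * p_z q * p_zbar q"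
    and "d_zbar (hamiltonian g) q = - 2 * dzbar (\<lambda>z. of_real (g z)) (q_z q) / G\<^sup>2 * p_z q * p_zbar q"
    and "hamiltonian g differentiable at q"
proof -
  let ?g = "\<lambda>z. complex_of_real (g z)"
  let ?D = "frechet_derivative ?g (at (q_z q))"
  have "?g differentiable at (q_z q)"
    using assms(1) by (rule differentiable_of_real)
  then have D: "(?g has_derivative ?D) (at (q_z q))"
    using frechet_derivative_works by blast
  then have D0: "?D 0 = 0"
    by (rule linear_0[OF has_derivative_linear])
  define h where "h q = ?g (q_z q)" for q
  have h: "(h has_derivative (\<lambda>v. ?D (q_z v))) (at q)" and hq: "h q = G" "G \<noteq> 0"
    using has_derivative_compose[OF has_derivative_coords(1) D] assms(2)
    by (simp_all add: h_def[abs_def] G_def)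
  have "((\<lambda>q. 2 * inverse (h q) * p_z q * p_zbar q) has_derivative (\<lambda>v.
      - 2 * ?D (q_z v) / G\<^sup>2 * p_z q * p_zbar q
      + 2 / G * (p_z v * p_zbar q + p_z q * p_zbar v))) (at q)"
    using hq by (auto intro!: derivative_eq_intros has_derivative_coords h
        simp: field_simps power2_eq_square)
  then have H: "(hamiltonian g has_derivative (\<lambda>v.
      - 2 * ?D (q_z v) / G\<^sup>2 * p_z q * p_zbar q
      + 2 / G * (p_z v * p_zbar q + p_z q * p_zbar v))) (at q)"
    unfolding h_def hamiltonian_def[abs_def] .
  from frechet_derivative_at[OF this, symmetric] D0
  show "d_pz (hamiltonian g) q = 2 / G * p_zbar q"
    and "d_pzbar (hamiltonian g) q = 2 / G * p_z q"
    and "d_z (hamiltonian g) q = - 2 * dz (\<lambda>z. of_real (g z)) (q_z q) / G\<^sup>2 * p_z q * p_zbar q"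
    and "d_zbar (hamiltonian g) q = - 2 * dzbar (\<lambda>z. of_real (g z)) (q_z q) / G\<^sup>2 * p_z q * p_zbar q"
    by (simp_all add: d_pz_def d_pzbar_def d_z_def d_zbar_def dz_def dzbar_def)
      (simp_all add: q_z_def p_z_def p_zbar_def case_prod_unfold add_divide_distrib diff_divide_distrib algebra_simps)
  show "hamiltonian g differentiable at q"
    using H unfolding differentiable_def by blast
qed

lemma poisson_self: "poisson B F F q = 0"
  using poisson_antisym[of B F F q] by (simp add: eq_neg_iff_add_eq_0)

lemma p_zbar_eq_cnj: "p_zbar q = cnj (p_z q)"
  by (simp add: p_z_def p_zbar_def case_prod_unfold)

text \<open>The factor \<open>g z / 2\<close> clears the common \<open>2 / g\<close> of the momentum
  derivatives of \<open>H\<close>. The terms pair off into complex conjugates, hence the real part.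
  As \<open>{H, H} = 0\<close>, the coefficient \<open>a\<^sub>0\<^sub>2\<close> enters only through
  its derivatives, and \<open>H\<close> stays unexpanded because it is a constant on each
  level.\<close>

lemma poisson_quadratic:
  fixes z P :: complex
  assumes "g differentiable at z" "a\<^sub>0\<^sub>1 differentiable at z" "a\<^sub>0\<^sub>2 differentiable at z"
    and "a\<^sub>1 differentiable at z" "a\<^sub>2 differentiable at z"
    and "g z > 0" and q: "q_z q = z" "p_z q = P"
  defines "g\<^sub>z \<equiv> dz (\<lambda>z. of_real (g z)) z"
  shows "g z / 2 * poisson B (quadratic_fn g a\<^sub>2 a\<^sub>1 a\<^sub>0\<^sub>1 a\<^sub>0\<^sub>2) (hamiltonian g) q = of_real (2 * Re (
      dzbar a\<^sub>2 z * P ^ 3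
    + (dz a\<^sub>2 z + 2 * a\<^sub>2 z * g\<^sub>z / g z) * P ^ 2 * cnj P
    + (dzbar a\<^sub>1 z + 2 * \<i> * B z * a\<^sub>2 z) * P ^ 2
    + (dz a\<^sub>1 z + a\<^sub>1 z * g\<^sub>z / g z) * P * cnj P
    + (dzbar (\<lambda>z. of_real (a\<^sub>0\<^sub>1 z)) z + dzbar (\<lambda>z. of_real (a\<^sub>0\<^sub>2 z)) z * hamiltonian g q
       + \<i> * B z * a\<^sub>1 z) * P))"
proof -
  let ?H = "hamiltonian g"
  define A2 A1 A01 A02 C1 C2 :: "phase \<Rightarrow> complex"
    where A2: "A2 = (\<lambda>q. a\<^sub>2 (q_z q))" and A1: "A1 = (\<lambda>q. a\<^sub>1 (q_z q))"
      and A01: "A01 = (\<lambda>q. of_real (a\<^sub>0\<^sub>1 (q_z q)))" and A02: "A02 = (\<lambda>q. of_real (a\<^sub>0\<^sub>2 (q_z q)))"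
      and C1: "C1 = (\<lambda>q. cnj (a\<^sub>1 (q_z q)))" and C2: "C2 = (\<lambda>q. cnj (a\<^sub>2 (q_z q)))"
  note base = \<open>a\<^sub>1 differentiable at z\<close> \<open>a\<^sub>2 differentiable at z\<close>
    differentiable_of_real[OF \<open>a\<^sub>0\<^sub>1 differentiable at z\<close>] differentiable_of_real[OF \<open>a\<^sub>0\<^sub>2 differentiable at z\<close>]
    differentiable_cnj[OF \<open>a\<^sub>1 differentiable at z\<close>] differentiable_cnj[OF \<open>a\<^sub>2 differentiable at z\<close>]
  note base' = base[folded q(1)]
  note ham = hamiltonian_derivatives[of g q, unfolded q, OF \<open>g differentiable at z\<close>]
  have ham': "g z \<noteq> 0" using \<open>g z > 0\<close> by simp
  have diff: "A2 differentiable at q" "A1 differentiable at q" "A01 differentiable at q"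
    "A02 differentiable at q" "C1 differentiable at q" "C2 differentiable at q"
    "?H differentiable at q"
    unfolding A2 A1 A01 A02 C1 C2 by (rule base'[THEN differentiable_lift] ham(5)[OF ham'])+
  have "quadratic_fn g a\<^sub>2 a\<^sub>1 a\<^sub>0\<^sub>1 a\<^sub>0\<^sub>2 = (\<lambda>q. A2 q * (p_z q * p_z q) + A1 q * p_z q + A01 q
      + A02 q * ?H q + C1 q * p_zbar q + C2 q * (p_zbar q * p_zbar q))"
    by (simp add: fun_eq_iff quadratic_fn_def A2 A1 A01 A02 C1 C2 power2_eq_square)
  then have "poisson B (quadratic_fn g a\<^sub>2 a\<^sub>1 a\<^sub>0\<^sub>1 a\<^sub>0\<^sub>2) ?H q =
      A2 q * (2 * P * poisson B p_z ?H q) + poisson B A2 ?H q * P\<^sup>2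
    + (A1 q * poisson B p_z ?H q + poisson B A1 ?H q * P) + poisson B A01 ?H q
    + poisson B A02 ?H q * ?H q
    + (C1 q * poisson B p_zbar ?H q + poisson B C1 ?H q * cnj P)
    + (C2 q * (2 * cnj P * poisson B p_zbar ?H q) + poisson B C2 ?H q * (cnj P)\<^sup>2)"
    by (simp add: poisson_add poisson_mult diff differentiable_p differentiable_mult differentiable_add
        poisson_self q p_zbar_eq_cnj[of q] power2_eq_square)
  moreover define h where "h = ?H q"
  moreover have "cnj h = h"
    by (simp add: h_def hamiltonian_def p_zbar_eq_cnj)
  moreover define G where "G = complex_of_real (g z)"
  moreover have "G \<noteq> 0" "cnj G = G"
    using ham' by (auto simp: G_def)
  moreover have "dzbar (\<lambda>z. of_real (g z)) z = cnj g\<^sub>z"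
    using wirtinger_of_real[OF \<open>g differentiable at z\<close>] by (simp add: g\<^sub>z_def)
  ultimately show ?thesis
    unfolding A2 A1 A01 A02 C1 C2
    by (simp only: poisson_lift[OF base'(1)] poisson_lift[OF base'(2)] poisson_lift[OF base'(3)]
          poisson_lift[OF base'(4)] poisson_lift[OF base'(5)] poisson_lift[OF base'(6)]
          poisson_p ham[OF ham'] q p_zbar_eq_cnj,
        simp only: wirtinger_cnj[OF base(1)] wirtinger_cnj[OF base(2)]
          wirtinger_of_real[OF \<open>a\<^sub>0\<^sub>1 differentiable at z\<close>]
          wirtinger_of_real[OF \<open>a\<^sub>0\<^sub>2 differentiable at z\<close>]
          g\<^sub>z_def[symmetric] complex_add_cnj[symmetric],
        simp add: field_simps power2_eq_square power3_eq_cube)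
qed

subsection \<open>First integrals on energy levels\<close>

text \<open>On the circle this is a trigonometric polynomial with frequencies 0 to 3, and the eight
  points at multiples of 45 degrees determine its coefficients. The axis points give
  \<open>K\<close>, \<open>Re C\<close> and \<open>D\<close> in terms of \<open>A\<close>; the
  diagonal points give \<open>Im C\<close> and then \<open>A\<close>.\<close>

lemma cubic_trig_poly_eq_0:
  fixes A C D :: complex and K r :: real
  assumes "r > 0" and zero: "\<And>P. cmod P = r \<Longrightarrow> Re (A * P ^ 3 + C * P ^ 2 + D * P) + K = 0"
  shows "A = 0" "C = 0" "D = 0" "K = 0"
proof -
  define s where "s = r / sqrt 2"
  have s: "s > 0" "s * s * 2 = r * r"
    using \<open>r > 0\<close> by (simp_all add: s_def)
  have "cmod (Complex s s) = r" "cmod (Complex s (-s)) = r" "cmod (Complex (-s) s) = r"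
      "cmod (Complex (-s) (-s)) = r"
    using s \<open>r > 0\<close> by (simp_all add: cmod_def power2_eq_square real_sqrt_unique)
  note diag = this[THEN zero]
  have "cmod (Complex r 0) = r" "cmod (Complex (-r) 0) = r" "cmod (Complex 0 r) = r"
      "cmod (Complex 0 (-r)) = r"
    using \<open>r > 0\<close> by (simp_all add: cmod_def)
  note axis = this[THEN zero]
  have "r * r * Re C + K = 0" "- r * r * Re C + K = 0"
    using axis by (auto simp: power2_eq_square power3_eq_cube algebra_simps)
  then have "K = 0" "r * r * Re C = 0" by auto
  have "2 * s * s * Im C = 0"
    using diag \<open>K = 0\<close> by (auto simp: power2_eq_square power3_eq_cube algebra_simps)
  have "r * (r * r * Re A + Re D) = 0" "r * (r * r * Im A - Im D) = 0"
    using axis \<open>K = 0\<close> by (auto simp: power2_eq_square power3_eq_cube algebra_simps)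
  then have 1: "Re D = - (r * r * Re A)" "Im D = r * r * Im A"
    using \<open>r > 0\<close> by auto
  have "s * ((s * s * 2) * (- Re A - Im A) + Re D - Im D) = 0"
       "s * ((s * s * 2) * (Re A - Im A) - Re D - Im D) = 0"
    using diag \<open>K = 0\<close> \<open>2 * s * s * Im C = 0\<close>
    by (auto simp: power2_eq_square power3_eq_cube algebra_simps)
  then have "r * r * (- Re A - Im A) + Re D - Im D = 0" "r * r * (Re A - Im A) - Re D - Im D = 0"
    using s by auto
  with 1 have "r * r * Re A = 0" "r * r * Im A = 0"
    by (auto simp: algebra_simps)
  then show "A = 0" "C = 0" "D = 0" "K = 0"
    using 1 \<open>r * r * Re C = 0\<close> \<open>2 * s * s * Im C = 0\<close> \<open>K = 0\<close> s \<open>r > 0\<close> by (auto simp: complex_eq_iff)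
qed

lemma Re_of_real_mult: "Re (of_real c * w) = c * Re w"
  by simp

text \<open>Over a fixed base point the level is a circle in \<open>P = p_z\<close>, so the bracket
  is a trigonometric polynomial in the angle of \<open>P\<close> and every coefficient vanishes.
  Since \<open>P * cnj P\<close> is constant there, the term in \<open>P^2 * cnj P\<close> joins the
  frequency-one term, which makes the third equation affine in \<open>E\<close>.\<close>

lemma quadratic_integral_on_level:
  assumes diff: "g differentiable at z" "a\<^sub>0\<^sub>1 differentiable at z" "a\<^sub>0\<^sub>2 differentiable at z"
    "a\<^sub>1 differentiable at z" "a\<^sub>2 differentiable at z"
    and "g z > 0" "E > 0"
    and int: "first_integral_on_level g B E (quadratic_fn g a\<^sub>2 a\<^sub>1 a\<^sub>0\<^sub>1 a\<^sub>0\<^sub>2)"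
  defines "g\<^sub>z \<equiv> dz (\<lambda>z. of_real (g z)) z"
  shows "dzbar a\<^sub>2 z = 0"
    and "dzbar a\<^sub>1 z + 2 * \<i> * B z * a\<^sub>2 z = 0"
    and "dzbar (\<lambda>z. of_real (a\<^sub>0\<^sub>1 z)) z + \<i> * B z * a\<^sub>1 z
      + E * (dzbar (\<lambda>z. of_real (a\<^sub>0\<^sub>2 z)) z + (dz a\<^sub>2 z + 2 * a\<^sub>2 z * g\<^sub>z / g z) * (g z / 2)) = 0"
      (is "?D = 0")
    and "Re (dz a\<^sub>1 z + a\<^sub>1 z * g\<^sub>z / g z) = 0"
proof -
  \<comment> \<open>Solves \<open>2 * r^2 / g z = E\<close>, the level equation with
    \<open>r\<close> the modulus of \<open>p_z\<close>.\<close>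
  define r where "r = sqrt (g z * E / 2)"
  have "r > 0" "r\<^sup>2 = g z * E / 2"
    using assms(6,7) by (simp_all add: r_def)
  let ?K = "r\<^sup>2 * Re (dz a\<^sub>1 z + a\<^sub>1 z * g\<^sub>z / g z)"
  have "Re (dzbar a\<^sub>2 z * P ^ 3 + (dzbar a\<^sub>1 z + 2 * \<i> * B z * a\<^sub>2 z) * P\<^sup>2 + ?D * P) + ?K = 0"
    if "cmod P = r" for P
  proof -
    \<comment> \<open>Inverts \<open>p_z\<close>, whose definition contains the factor one half and
      a minus sign at the second momentum.\<close>
    define q :: phase where "q = (z, 2 * Re P, - 2 * Im P)"
    have q: "q_z q = z" "p_z q = P"
      by (simp_all add: q_def q_z_def p_z_def complex_eq_iff)
    have PP: "P * cnj P = of_real (g z * E / 2)"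
      using \<open>r\<^sup>2 = _\<close> that by (metis complex_norm_square)
    then have H: "hamiltonian g q = E"
      using \<open>g z > 0\<close> by (simp add: hamiltonian_def q p_zbar_eq_cnj field_simps)
    let ?c = "dz a\<^sub>2 z + 2 * a\<^sub>2 z * g\<^sub>z / g z"
    have 0: "poisson B (quadratic_fn g a\<^sub>2 a\<^sub>1 a\<^sub>0\<^sub>1 a\<^sub>0\<^sub>2) (hamiltonian g) q = 0"
      using int H unfolding first_integral_on_level_def by blast
    let ?T = "dzbar a\<^sub>2 z * P ^ 3 + ?c * P ^ 2 * cnj P
      + (dzbar a\<^sub>1 z + 2 * \<i> * B z * a\<^sub>2 z) * P ^ 2
      + (dz a\<^sub>1 z + a\<^sub>1 z * g\<^sub>z / g z) * P * cnj P
      + (dzbar (\<lambda>z. of_real (a\<^sub>0\<^sub>1 z)) z + dzbar (\<lambda>z. of_real (a\<^sub>0\<^sub>2 z)) z * E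
       + \<i> * B z * a\<^sub>1 z) * P"
    have "complex_of_real (2 * Re ?T) = 0"
      using poisson_quadratic[where B = B, OF diff \<open>g z > 0\<close> q]
      unfolding H 0 mult_zero_right g\<^sub>z_def by (rule sym)
    then have "Re ?T = 0"
      by (simp only: of_real_eq_0_iff mult_eq_0_iff) simp
    moreover have "?T = dzbar a\<^sub>2 z * P ^ 3 + ?c * P * (P * cnj P)
      + (dzbar a\<^sub>1 z + 2 * \<i> * B z * a\<^sub>2 z) * P ^ 2
      + (dz a\<^sub>1 z + a\<^sub>1 z * g\<^sub>z / g z) * (P * cnj P)
      + (dzbar (\<lambda>z. of_real (a\<^sub>0\<^sub>1 z)) z + dzbar (\<lambda>z. of_real (a\<^sub>0\<^sub>2 z)) z * E
       + \<i> * B z * a\<^sub>1 z) * P"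
      by (simp add: power2_eq_square mult_ac)
    moreover have "\<dots> = dzbar a\<^sub>2 z * P ^ 3 + (dzbar a\<^sub>1 z + 2 * \<i> * B z * a\<^sub>2 z) * P\<^sup>2 + ?D * P
        + of_real (r\<^sup>2) * (dz a\<^sub>1 z + a\<^sub>1 z * g\<^sub>z / g z)"
      unfolding PP \<open>r\<^sup>2 = _\<close> by (simp add: algebra_simps)
    ultimately show ?thesis
      by (simp only: plus_complex.sel Re_of_real_mult)
  qed
  note coeffs = cubic_trig_poly_eq_0[OF \<open>r > 0\<close> this]
  show "dzbar a\<^sub>2 z = 0" by (rule coeffs(1))
  show "dzbar a\<^sub>1 z + 2 * \<i> * B z * a\<^sub>2 z = 0" by (rule coeffs(2))
  show "?D = 0" by (rule coeffs(3))
  show "Re (dz a\<^sub>1 z + a\<^sub>1 z * g\<^sub>z / g z) = 0"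
    using coeffs(4) \<open>r > 0\<close> by simp
qed

text \<open>Subtracting gives \<open>L = 0\<close> first. This is how the second energy level is
  used: it separates the magnetic part \<open>K\<close> of the frequency-one equation from the part
  \<open>L\<close> carrying the metric and \<open>a\<^sub>0\<^sub>2\<close>.\<close>

lemma two_levels_eq_0:
  fixes K L :: complex
  assumes "K + of_real E1 * L = 0" "K + of_real E2 * L = 0" "E1 \<noteq> E2"
  shows "K = 0"
proof -
  have "of_real (E1 - E2) * L = (K + of_real E1 * L) - (K + of_real E2 * L)"
    by (simp add: algebra_simps)
  then have "of_real (E1 - E2) * L = 0"
    using assms by simp
  then show ?thesis
    using assms by simp
qed

text \<open>A linear function is a quadratic one with
  \<open>a\<^sub>2 = a\<^sub>0\<^sub>2 = 0\<close>. For constant \<open>a\<close> the coefficients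
  of the bracket left in \<open>poisson_quadratic\<close> are those of \<open>P\<close> and of
  \<open>P * cnj P\<close>, which the last two hypotheses remove.\<close>

lemma first_integral_linear_const:
  assumes diff: "\<And>z. g differentiable at z" "\<And>z. b differentiable at z" and "\<And>z. g z > 0"
    and "\<And>z. dzbar (\<lambda>z. of_real (b z)) z = - \<i> * B z * a"
    and "\<And>z. Re (a * dz (\<lambda>z. of_real (g z)) z) = 0"
  shows "first_integral g B (linear_fn (\<lambda>_. a) b)"
  unfolding first_integral_def
proof
  fix q
  define z where "z = q_z q"
  have wirtinger_const: "dz (\<lambda>_. c) z = 0" "dzbar (\<lambda>_. c) z = 0" for c
    using wirtinger_unique[of "\<lambda>_. c" 0 0 z] by simp_all
  have eq: "linear_fn (\<lambda>_. a) b = quadratic_fn g (\<lambda>_. 0) (\<lambda>_. a) b (\<lambda>_. 0)"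
    by (simp add: fun_eq_iff linear_fn_def quadratic_fn_def)
  have "g z / 2 * poisson B (linear_fn (\<lambda>_. a) b) (hamiltonian g) q
      = of_real (2 * Re (a * dz (\<lambda>z. of_real (g z)) z / g z * (p_z q * cnj (p_z q))))"
    unfolding eq using assms(3) assms(4)[of z]
      poisson_quadratic[of g z b "\<lambda>_. 0" "\<lambda>_. a" "\<lambda>_. 0" q "p_z q" B] diff
    by (simp add: z_def[symmetric] wirtinger_const mult.assoc
        del: times_complex.sel of_real_mult of_real_add of_real_diff)
  also have "a * dz (\<lambda>z. of_real (g z)) z / g z * (p_z q * cnj (p_z q))
      = of_real ((cmod (p_z q))\<^sup>2 / g z) * (a * dz (\<lambda>z. of_real (g z)) z)"
    by (simp add: complex_norm_square[symmetric])
  also have "Re \<dots> = 0"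
    by (simp only: Re_of_real_mult assms(5) mult_zero_right)
  finally show "poisson B (linear_fn (\<lambda>_. a) b) (hamiltonian g) q = 0"
    using assms(3)[of z] by simp
qed

subsection \<open>Directional derivatives and a Burgers-type equation\<close>

abbreviation dirderiv :: "complex \<Rightarrow> (complex \<Rightarrow> real) \<Rightarrow> complex \<Rightarrow> real" where
  "dirderiv v f z \<equiv> frechet_derivative f (at z) v"

lemma has_real_derivative_line:
  fixes f :: "complex \<Rightarrow> real"
  assumes "f differentiable at (z + t *\<^sub>R v)"
  shows "((\<lambda>t. f (z + t *\<^sub>R v)) has_real_derivative dirderiv v f (z + t *\<^sub>R v)) (at t)"
proof -
  let ?D = "frechet_derivative f (at (z + t *\<^sub>R v))"
  have D: "(f has_derivative ?D) (at (z + t *\<^sub>R v))"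
    using assms frechet_derivative_works by blast
  have "((\<lambda>t. z + t *\<^sub>R v) has_derivative (\<lambda>h. h *\<^sub>R v)) (at t)"
    by (auto intro!: derivative_eq_intros)
  from has_derivative_compose[OF this D]
  have "((\<lambda>t. f (z + t *\<^sub>R v)) has_derivative (\<lambda>h. ?D (h *\<^sub>R v))) (at t)" .
  moreover have "?D (h *\<^sub>R v) = ?D v * h" for h
    using linear_scale[OF has_derivative_linear[OF D], of h v] by simp
  ultimately show ?thesis
    by (simp add: has_field_derivative_def mult_commute_abs)
qed

lemma dirderiv_combination:
  fixes f :: "complex \<Rightarrow> real"
  assumes "f differentiable at z"
  shows "dirderiv (a *\<^sub>R v + b *\<^sub>R w) f z = a * dirderiv v f z + b * dirderiv w f z"
proof -
  have "linear (frechet_derivative f (at z))"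
    using assms by (rule linear_frechet_derivative)
  then show ?thesis
    by (simp add: linear_add linear_scale)
qed

lemma dirderiv_mult:
  fixes f h :: "complex \<Rightarrow> real"
  assumes "f differentiable at z" "h differentiable at z"
  shows "dirderiv v (\<lambda>z. f z * h z) z = f z * dirderiv v h z + dirderiv v f z * h z"
proof -
  have "((\<lambda>z. f z * h z) has_derivative
      (\<lambda>v. f z * dirderiv v h z + dirderiv v f z * h z)) (at z)"
    using assms by (intro has_derivative_mult) (simp_all add: frechet_derivative_works)
  from frechet_derivative_at[OF this] show ?thesis by metis
qed

lemma frechet_derivative_translate:
  assumes "f differentiable at (z + t)"
  shows "frechet_derivative (\<lambda>w. f (w + t)) (at z) = frechet_derivative f (at (z + t))"
proof -
  have "((\<lambda>w. w + t) has_derivative (\<lambda>h. h)) (at z)"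
    by (auto intro!: derivative_eq_intros)
  from has_derivative_compose[OF this] assms
  have "((\<lambda>w. f (w + t)) has_derivative frechet_derivative f (at (z + t))) (at z)"
    using frechet_derivative_works by blast
  from frechet_derivative_at[OF this] show ?thesis by simp
qed

text \<open>The parameters for which the line lies in \<open>S\<close> form a convex set, on which
  the restricted function has derivative zero.\<close>

lemma dirderiv_eq_0_imp_translation_invariant:
  fixes f :: "complex \<Rightarrow> real"
  assumes "convex S" and "\<And>w. w \<in> S \<Longrightarrow> f differentiable at w \<and> dirderiv v f w = 0"
    and "z \<in> S" "z + t *\<^sub>R v \<in> S"
  shows "f (z + t *\<^sub>R v) = f z"
proof -
  let ?h = "\<lambda>t. z + t *\<^sub>R v"
  let ?I = "{t. ?h t \<in> S}"
  have "convex ?I"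
  proof (rule convexI)
    fix s t a b :: real
    assume "s \<in> ?I" "t \<in> ?I" and ab: "0 \<le> a" "0 \<le> b" "a + b = 1"
    then have "a *\<^sub>R ?h s + b *\<^sub>R ?h t \<in> S"
      using \<open>convex S\<close> by (simp add: convexD)
    moreover have "a *\<^sub>R ?h s + b *\<^sub>R ?h t = (a + b) *\<^sub>R z + (a * s + b * t) *\<^sub>R v"
      by (simp add: algebra_simps)
    ultimately show "a *\<^sub>R s + b *\<^sub>R t \<in> ?I"
      using ab by simp
  qed
  moreover have "((\<lambda>t. f (?h t)) has_real_derivative 0) (at s within ?I)" if "s \<in> ?I" for s
    using has_real_derivative_line[of f z s v] assms(2)[of "?h s"] that
    by (simp add: has_field_derivative_at_within)
  ultimately obtain c where "\<forall>s\<in>?I. f (?h s) = c"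
    using has_field_derivative_zero_constant by blast
  moreover have "0 \<in> ?I" "t \<in> ?I"
    using assms by auto
  ultimately have "f (?h t) = f (?h 0)"
    by metis
  then show ?thesis by simp
qed

text \<open>The weighted square \<open>exp (- 2 * M * s) * (f s)^2\<close> is nonincreasing and
  starts at 0, which settles positive times; reflection \<open>t\<close> to \<open>- t\<close>
  preserves the hypothesis and settles negative ones.\<close>

lemma gronwall_zero:
  fixes f :: "real \<Rightarrow> real"
  assumes "\<And>t. \<exists>f'. (f has_real_derivative f') (at t) \<and> \<bar>f'\<bar> \<le> M * \<bar>f t\<bar>" and "f 0 = 0"
  shows "f t = 0"
proof -
  have forward: "h t = 0"
    if h: "\<And>t. \<exists>h'. (h has_real_derivative h') (at t) \<and> \<bar>h'\<bar> \<le> M * \<bar>h t\<bar>" and "h 0 = 0" "t \<ge> 0"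
    for h :: "real \<Rightarrow> real" and t
  proof -
    let ?e = "\<lambda>s. exp (- 2 * M * s) * (h s)\<^sup>2"
    have "?e t \<le> ?e 0"
    proof (rule DERIV_nonpos_imp_nonincreasing[OF \<open>t \<ge> 0\<close>])
      fix s
      obtain h' where h': "(h has_real_derivative h') (at s)" "\<bar>h'\<bar> \<le> M * \<bar>h s\<bar>"
        using h by blast
      have "(?e has_real_derivative exp (- 2 * M * s) * (2 * (h s * h' - M * (h s)\<^sup>2))) (at s)"
        using h'(1) by (auto intro!: derivative_eq_intros simp: algebra_simps)
      moreover have "h s * h' \<le> M * (h s)\<^sup>2"
      proof -
        have "h s * h' \<le> \<bar>h s\<bar> * \<bar>h'\<bar>"
          by (metis abs_ge_self abs_mult)
        also have "\<dots> \<le> \<bar>h s\<bar> * (M * \<bar>h s\<bar>)"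
          using h'(2) by (intro mult_left_mono) auto
        finally show ?thesis
          by (simp add: power2_eq_square mult.left_commute flip: abs_mult)
      qed
      moreover have "exp (- 2 * M * s) * (2 * (h s * h' - M * (h s)\<^sup>2)) \<le> 0"
        using \<open>h s * h' \<le> _\<close> by (intro mult_nonneg_nonpos) auto
      ultimately show "\<exists>y. (?e has_real_derivative y) (at s) \<and> y \<le> 0"
        by blast
    qed
    then have "(h t)\<^sup>2 \<le> 0"
      using \<open>h 0 = 0\<close> by (simp add: mult_le_0_iff)
    then show ?thesis by simp
  qed
  show ?thesis
  proof (cases "t \<ge> 0")
    case True
    then show ?thesis using forward[of f t] assms by blast
  next
    case False
    have "\<exists>h'. ((\<lambda>t. f (- t)) has_real_derivative h') (at s) \<and> \<bar>h'\<bar> \<le> M * \<bar>f (- s)\<bar>" for s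
    proof -
      obtain f' where f': "(f has_real_derivative f') (at (- s))" "\<bar>f'\<bar> \<le> M * \<bar>f (- s)\<bar>"
        using assms(1) by blast
      then have "((\<lambda>t. f (- t)) has_real_derivative - f') (at s)"
        using DERIV_mirror by (metis minus_minus)
      with f'(2) show ?thesis by (metis abs_minus_cancel)
    qed
    from forward[OF this, of "- t"] False assms(2) show ?thesis by simp
  qed
qed

text \<open>The quotient \<open>c / u^2\<close> acts as a wave speed. Since \<open>u\<close> is
  defined on the whole plane, characteristics are complete lines, and two with different speeds
  would cross where \<open>u\<close> takes both values. The bounds \<open>K\<close> and
  \<open>L\<close> supply the Gronwall constant.\<close>

lemma product_constant_imp_dirderiv_0:
  fixes u v :: "complex \<Rightarrow> real"
  assumes span: "\<And>z. \<exists>a b. z = a *\<^sub>R \<xi> + b *\<^sub>R \<eta>"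
    and du: "\<And>z. u differentiable at z" and dv: "\<And>z. v differentiable at z"
    and pde: "\<And>z. dirderiv \<xi> u z = dirderiv \<eta> v z"
    and uv: "\<And>z. u z * v z = c" and "c \<noteq> 0"
    and K: "\<And>z. \<bar>v z\<bar> \<le> K" "\<And>z. \<bar>u z\<bar> \<le> K" and L: "\<And>z. \<bar>dirderiv \<eta> u z\<bar> \<le> L"
  shows "dirderiv w u z = 0" "dirderiv w v z = 0"
proof -
  have nz: "u z \<noteq> 0" "v z \<noteq> 0" for z
    using uv[of z] \<open>c \<noteq> 0\<close> by auto
  have "K > 0"
    using K(2)[of 0] nz(1)[of 0] by (smt (verit))
  have v: "v z = c / u z" for z
    using uv[of z] nz[of z] by (simp add: field_simps)
  \<comment> \<open>Differentiate the constant product along \<open>\<eta>\<close>, replace the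
    derivative of \<open>v\<close> by that of \<open>u\<close> along \<open>\<xi>\<close>, and
    multiply by \<open>u\<close>.\<close>
  have burgers: "(u z)\<^sup>2 * dirderiv \<xi> u z = - c * dirderiv \<eta> u z" for z
  proof -
    have "dirderiv \<eta> (\<lambda>z. u z * v z) z = 0"
      by (simp add: uv frechet_derivative_const)
    then have "u z * dirderiv \<eta> v z = - (dirderiv \<eta> u z * v z)"
      by (simp add: dirderiv_mult[OF du dv])
    then have "u z * (u z * dirderiv \<xi> u z) = - (dirderiv \<eta> u z * (u z * v z))"
      by (simp add: pde)
    then show ?thesis
      by (simp add: uv power2_eq_square mult_ac)
  qed
  have low: "\<bar>c\<bar> / K \<le> \<bar>u z\<bar>" for z
  proof -
    have "\<bar>c\<bar> = \<bar>u z\<bar> * \<bar>v z\<bar>"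
      using uv[of z] by (simp add: abs_mult[symmetric])
    also have "\<dots> \<le> \<bar>u z\<bar> * K"
      by (rule mult_left_mono[OF K(1)]) simp
    finally show ?thesis
      using \<open>K > 0\<close> by (simp add: field_simps)
  qed
  define m where "m = \<bar>c\<bar> / K"
  have "m > 0"
    using \<open>c \<noteq> 0\<close> \<open>K > 0\<close> by (simp add: m_def)
  \<comment> \<open>Instead of solving the characteristic equation, the speed is frozen at its value
    at \<open>z0\<close>. The derivative of \<open>u\<close> along that line is then a bounded
    multiple of the deviation \<open>u - u z0\<close>, because the difference of the two speeds
    contains this factor.\<close>
  have characteristic: "u (z0 + t *\<^sub>R (\<xi> + (c / (u z0)\<^sup>2) *\<^sub>R \<eta>)) = u z0" for z0 t
  proof -
    let ?d = "\<xi> + (c / (u z0)\<^sup>2) *\<^sub>R \<eta>"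
    let ?f = "\<lambda>t. u (z0 + t *\<^sub>R ?d) - u z0"
    have "\<exists>f'. (?f has_real_derivative f') (at t) \<and> \<bar>f'\<bar> \<le> (\<bar>c\<bar> * L * (2 * K) / (m\<^sup>2 * m\<^sup>2)) * \<bar>?f t\<bar>" for t
    proof -
      let ?z = "z0 + t *\<^sub>R ?d"
      let ?f' = "dirderiv ?d u ?z"
      have "(?f has_real_derivative ?f') (at t)"
        using has_real_derivative_line[where z = z0 and t = t and v = ?d, OF du] by (auto intro!: derivative_eq_intros)
      have "?f' = dirderiv \<xi> u ?z + c / (u z0)\<^sup>2 * dirderiv \<eta> u ?z"
        using dirderiv_combination[where a = 1 and v = \<xi> and w = \<eta>, OF du] by simp
      also have "dirderiv \<xi> u ?z = - c * dirderiv \<eta> u ?z / (u ?z)\<^sup>2"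
        using burgers[of ?z] nz[of ?z] by (simp add: field_simps)
      also have "- c * dirderiv \<eta> u ?z / (u ?z)\<^sup>2 + c / (u z0)\<^sup>2 * dirderiv \<eta> u ?z
          = c * dirderiv \<eta> u ?z * (u ?z + u z0) / ((u ?z)\<^sup>2 * (u z0)\<^sup>2) * ?f t"
        using nz[of ?z] nz[of z0] by (simp add: divide_simps) (simp add: power2_eq_square algebra_simps)
      finally have "\<bar>?f'\<bar> = \<bar>c\<bar> * \<bar>dirderiv \<eta> u ?z\<bar> * \<bar>u ?z + u z0\<bar> / ((u ?z)\<^sup>2 * (u z0)\<^sup>2) * \<bar>?f t\<bar>"
        by (simp add: abs_mult)
      also have "\<dots> \<le> (\<bar>c\<bar> * L * (2 * K) / (m\<^sup>2 * m\<^sup>2)) * \<bar>?f t\<bar>"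
      proof -
        have "\<bar>u ?z + u z0\<bar> \<le> 2 * K"
          using K(2)[of ?z] K(2)[of z0] by linarith
        moreover have "m\<^sup>2 \<le> (u z)\<^sup>2" for z
          using power_mono[OF low[of z, folded m_def], of 2] \<open>m > 0\<close> by simp
        moreover have "0 \<le> L"
          using L[of 0] by linarith
        ultimately show ?thesis
          using \<open>K > 0\<close> \<open>m > 0\<close> L by (intro mult_right_mono frac_le mult_mono) auto
      qed
      finally show ?thesis
        using \<open>(?f has_real_derivative ?f') (at t)\<close> by blast
    qed
    from gronwall_zero[OF this, of t] show ?thesis by simp
  qed
  have sq: "(u z1)\<^sup>2 = (u z2)\<^sup>2" for z1 z2
  proof (rule ccontr)
    assume ne: "(u z1)\<^sup>2 \<noteq> (u z2)\<^sup>2"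
    define k1 k2 where "k1 = c / (u z1)\<^sup>2" and "k2 = c / (u z2)\<^sup>2"
    have "k1 - k2 \<noteq> 0"
      using ne nz[of z1] nz[of z2] \<open>c \<noteq> 0\<close> by (auto simp: k1_def k2_def field_simps)
    obtain a b where ab: "z2 - z1 = a *\<^sub>R \<xi> + b *\<^sub>R \<eta>"
      using span by blast
    \<comment> \<open>Time at which the line from \<open>z1\<close> reaches the intersection; the
      line from \<open>z2\<close> reaches it at time \<open>t - a\<close>.\<close>
    define t where "t = (b - a * k2) / (k1 - k2)"
    have "t * k1 = b + (t - a) * k2"
      using \<open>k1 - k2 \<noteq> 0\<close> by (simp add: t_def field_simps)
    then have "z1 + t *\<^sub>R (\<xi> + k1 *\<^sub>R \<eta>) = z1 + (a *\<^sub>R \<xi> + b *\<^sub>R \<eta>) + (t - a) *\<^sub>R (\<xi> + k2 *\<^sub>R \<eta>)"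
      by (simp add: scaleR_add_right scaleR_diff_left) (simp add: scaleR_add_left)
    also have "\<dots> = z2 + (t - a) *\<^sub>R (\<xi> + k2 *\<^sub>R \<eta>)"
      by (simp add: ab[symmetric])
    finally have "u z1 = u z2"
      using characteristic unfolding k1_def k2_def by metis
    with ne show False by simp
  qed
  \<comment> \<open>Only the square of \<open>u\<close> is known to be constant; its derivative is
    twice \<open>u\<close> times that of \<open>u\<close>, and \<open>u\<close> has no
    zeros.\<close>
  have Du: "dirderiv w u z = 0" for w z
  proof -
    have "(\<lambda>z. u z * u z) = (\<lambda>_. (u 0)\<^sup>2)"
      using sq[of _ 0] by (simp add: fun_eq_iff power2_eq_square)
    then have "dirderiv w (\<lambda>z. u z * u z) z = 0"
      by (simp add: frechet_derivative_const)
    then show ?thesis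
      using nz[of z] by (simp add: dirderiv_mult[OF du du])
  qed
  have "dirderiv w (\<lambda>z. u z * v z) z = 0"
    by (simp add: uv frechet_derivative_const)
  then show "dirderiv w u z = 0" "dirderiv w v z = 0"
    using nz[of z] by (simp_all add: dirderiv_mult[OF du dv] Du)
qed

subsection \<open>The degenerate case of vanishing product\<close>

lemma dirderiv_eq_0_of_vanishing:
  fixes f :: "complex \<Rightarrow> real"
  assumes "open S" "z \<in> S" "\<And>w. w \<in> S \<Longrightarrow> f w = 0" "f differentiable at z"
  shows "dirderiv v f z = 0"
  using frechet_derivative_transform_within_open[OF assms(4,1,2), of "\<lambda>_. 0"] assms(3)
  by (simp add: frechet_derivative_const)

text \<open>Split \<open>t\<close> into \<open>n\<close> equal steps shorter than
  \<open>\<delta>\<close> and iterate.\<close>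

lemma small_translations_imp_all:
  assumes "\<delta> > 0" and small: "\<And>z t::real. \<bar>t\<bar> < \<delta> \<Longrightarrow> f (z + t *\<^sub>R v) = f z"
  shows "f (z + t *\<^sub>R (v :: complex)) = f z"
proof -
  obtain n :: nat where n: "\<bar>t\<bar> < of_nat n * \<delta>"
    using reals_Archimedean3[OF \<open>\<delta> > 0\<close>] by blast
  then have "n > 0"
    by (cases n) auto
  define s where "s = t / n"
  have "\<bar>s\<bar> < \<delta>"
    using n \<open>n > 0\<close> by (simp add: s_def field_simps)
  have "f (z + (of_nat k * s) *\<^sub>R v) = f z" for k :: nat
  proof (induction k)
    case (Suc k)
    have "z + (of_nat (Suc k) * s) *\<^sub>R v = (z + (of_nat k * s) *\<^sub>R v) + s *\<^sub>R v"
      by (simp add: algebra_simps)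
    then show ?case
      using small[OF \<open>\<bar>s\<bar> < \<delta>\<close>] Suc.IH by metis
  qed simp
  from this[of n] show ?thesis
    using \<open>n > 0\<close> by (simp add: s_def)
qed

text \<open>Near a point with \<open>u\<close> nonzero, \<open>v\<close> vanishes, so
  \<open>u\<close> is constant along \<open>\<xi>\<close> and \<open>\<kappa> * B\<close> is the
  derivative of \<open>u\<close> along \<open>\<eta>\<close>. Hence \<open>B\<close> inherits the
  invariance locally, and analyticity spreads it over the plane.\<close>

lemma field_translation_invariant:
  fixes u v B :: "complex \<Rightarrow> real"
  assumes "real_analytic B" and "\<kappa> \<noteq> 0"
    and du: "\<And>z. u differentiable at z" and dv: "\<And>z. v differentiable at z"
    and pde1: "\<And>z. dirderiv \<xi> u z = dirderiv \<eta> v z"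
    and pde2: "\<And>z. dirderiv \<eta> u z + dirderiv \<xi> v z = \<kappa> * B z"
    and uv: "\<And>z. u z * v z = 0" and "u z1 \<noteq> 0"
  shows "B (z + t *\<^sub>R \<xi>) = B z"
proof -
  have "open {z. u z \<noteq> 0}"
    using du by (intro open_Collect_neq continuous_intros continuous_at_imp_continuous_on)
      (simp add: differentiable_imp_continuous_within)
  then obtain r where "r > 0" and r: "ball z1 r \<subseteq> {z. u z \<noteq> 0}"
    using \<open>u z1 \<noteq> 0\<close> by (auto simp: open_contains_ball)
  have v0: "v w = 0" if "w \<in> ball z1 r" for w
    using uv[of w] r that by auto
  have dv0: "dirderiv d v w = 0" if "w \<in> ball z1 r" for d w
    by (rule dirderiv_eq_0_of_vanishing[OF open_ball that v0 dv])
  \<comment> \<open>Translations by less than \<open>\<delta>\<close> keep the ball of half radius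
    inside the ball where \<open>u\<close> is nonzero.\<close>
  define \<delta> where "\<delta> = r / (2 * (norm \<xi> + 1))"
  have pos: "norm \<xi> + 1 > 0"
    by (simp add: add_nonneg_pos)
  then have "\<delta> > 0"
    using \<open>r > 0\<close> by (simp add: \<delta>_def)
  have "B (z + t *\<^sub>R \<xi>) = B z" if t: "\<bar>t\<bar> < \<delta>" for z t
  proof -
    have "\<bar>t\<bar> * norm \<xi> \<le> \<bar>t\<bar> * (norm \<xi> + 1)"
      by (intro mult_left_mono) auto
    also have "\<dots> < r / 2"
      using t pos by (simp add: \<delta>_def field_simps)
    finally have small: "norm (t *\<^sub>R \<xi>) < r / 2"
      by simp
    have in_ball: "w + t *\<^sub>R \<xi> \<in> ball z1 r" "w \<in> ball z1 r" if "w \<in> ball z1 (r / 2)" for w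
    proof -
      have "dist z1 (w + t *\<^sub>R \<xi>) \<le> dist z1 w + norm (t *\<^sub>R \<xi>)"
        using dist_triangle[of z1 "w + t *\<^sub>R \<xi>" w] by (simp add: dist_norm)
      then show "w + t *\<^sub>R \<xi> \<in> ball z1 r" "w \<in> ball z1 r"
        using that small \<open>r > 0\<close> by auto
    qed
    have u_inv: "u (w + t *\<^sub>R \<xi>) = u w" if "w \<in> ball z1 (r / 2)" for w
      by (rule dirderiv_eq_0_imp_translation_invariant[of "ball z1 r"])
         (use du dv0 pde1 in_ball[OF that] in auto)
    have "B (w + t *\<^sub>R \<xi>) - B w = 0" if w: "w \<in> ball z1 (r / 2)" for w
    proof -
      have "dirderiv \<eta> u w = dirderiv \<eta> (\<lambda>w. u (w + t *\<^sub>R \<xi>)) w"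
        using frechet_derivative_transform_within_open[OF du open_ball w, of "\<lambda>w. u (w + t *\<^sub>R \<xi>)"] u_inv
        by metis
      also have "\<dots> = dirderiv \<eta> u (w + t *\<^sub>R \<xi>)"
        by (simp add: frechet_derivative_translate du)
      finally have "\<kappa> * B w = \<kappa> * B (w + t *\<^sub>R \<xi>)"
        using pde2[of w] pde2[of "w + t *\<^sub>R \<xi>"] dv0 in_ball[OF w] by simp
      then show ?thesis
        using \<open>\<kappa> \<noteq> 0\<close> by simp
    qed
    then have "B (z + t *\<^sub>R \<xi>) - B z = 0"
      using real_analytic_identity[OF real_analytic_diff[OF
          real_analytic_translate[OF \<open>real_analytic B\<close>] \<open>real_analytic B\<close>] open_ball]
        \<open>r > 0\<close> by (metis ball_eq_empty half_gt_zero linorder_not_less)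
    then show ?thesis by simp
  qed
  then show ?thesis
    by (rule small_translations_imp_all[OF \<open>\<delta> > 0\<close>])
qed

text \<open>At a maximum of \<open>u^2\<close>, \<open>u\<close> is nonzero, so its derivatives
  vanish there, while \<open>v\<close> vanishes in a neighbourhood; both terms on the left of
  \<open>pde2\<close> are zero. The square rules out an extremum at a zero of
  \<open>u\<close>.\<close>

lemma field_vanishes_somewhere:
  fixes u v B :: "complex \<Rightarrow> real"
  assumes "\<kappa> \<noteq> 0" and "compact (range u)"
    and du: "\<And>z. u differentiable at z" and dv: "\<And>z. v differentiable at z"
    and pde2: "\<And>z. dirderiv \<eta> u z + dirderiv \<xi> v z = \<kappa> * B z"
    and uv: "\<And>z. u z * v z = 0" and "u z1 \<noteq> 0"
  shows "\<exists>z. B z = 0"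
proof -
  have cont: "continuous_on UNIV u"
    using du by (simp add: continuous_at_imp_continuous_on differentiable_imp_continuous_within)
  have "compact ((\<lambda>x. x * x) ` range u)"
    by (intro compact_continuous_image continuous_intros assms(2))
  then obtain z where z: "\<And>w. u w * u w \<le> u z * u z"
    using compact_attains_sup[of "(\<lambda>x. x * x) ` range u"] by auto
  have "u z \<noteq> 0"
    using z[of z1] \<open>u z1 \<noteq> 0\<close> by (metis mult_eq_0_iff not_square_less_zero order.not_eq_order_implies_strict zero_le_square)
  have "(\<lambda>z. u z * u z) differentiable at z"
    by (intro differentiable_mult du)
  then have "frechet_derivative (\<lambda>z. u z * u z) (at z) = (\<lambda>v. 0)"
    by (intro differential_zero_maxmin[where S = UNIV and x = z]) (use z in \<open>auto simp: frechet_derivative_works\<close>)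
  then have "dirderiv \<eta> u z = 0"
    using \<open>u z \<noteq> 0\<close> dirderiv_mult[where v = \<eta> and z = z, OF du du] by simp
  moreover have "dirderiv \<xi> v z = 0"
  proof (rule dirderiv_eq_0_of_vanishing[OF _ _ _ dv])
    show "open {z. u z \<noteq> 0}"
      by (intro open_Collect_neq continuous_on_const cont)
    show "v w = 0" if "w \<in> {z. u z \<noteq> 0}" for w
      using uv[of w] that by auto
  qed (use \<open>u z \<noteq> 0\<close> in auto)
  ultimately have "\<kappa> * B z = 0"
    using pde2[of z] by simp
  then show ?thesis
    using \<open>\<kappa> \<noteq> 0\<close> by auto
qed

text \<open>If the zero set of \<open>u\<close> has empty interior, its complement is dense and
  continuity extends the vanishing of the derivative of \<open>g\<close>. Otherwise \<open>B\<close>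
  vanishes on an open set, hence everywhere by analyticity.\<close>

lemma metric_translation_invariant:
  fixes u v g B :: "complex \<Rightarrow> real"
  assumes "real_analytic B" and "\<kappa> \<noteq> 0"
    and du: "\<And>z. u differentiable at z"
    and pde: "\<And>z. dirderiv \<eta> u z = \<kappa> * B z" and gu: "\<And>z. u z * dirderiv \<xi> g z = 0"
    and cont: "continuous_on UNIV (dirderiv \<xi> g)"
  shows "(\<forall>z. B z = 0) \<or> (\<forall>z. dirderiv \<xi> g z = 0)"
proof (cases "interior {z. u z = 0} = {}")
  case True
  have "closure {z. u z \<noteq> 0} = - interior {z. u z = 0}"
    by (simp add: Collect_neg_eq closure_complement)
  with True have "closure {z. u z \<noteq> 0} = UNIV" by simp
  moreover have "dirderiv \<xi> g z = 0" if "z \<in> {z. u z \<noteq> 0}" for z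
    using gu[of z] that by simp
  ultimately have "dirderiv \<xi> g z = 0" for z
    using continuous_constant_on_closure[where S = "{z. u z \<noteq> 0}" and f = "dirderiv \<xi> g" and a = 0] cont
    by (metis UNIV_I)
  then show ?thesis by blast
next
  case False
  have "B z = 0" if "z \<in> interior {z. u z = 0}" for z
  proof -
    have "dirderiv \<eta> u z = 0"
      using interior_subset by (intro dirderiv_eq_0_of_vanishing[OF open_interior that _ du]) blast
    then show ?thesis
      using pde[of z] \<open>\<kappa> \<noteq> 0\<close> by simp
  qed
  then show ?thesis
    using real_analytic_identity[OF \<open>real_analytic B\<close> open_interior False] by blast
qed

lemma product_zero_dichotomy:
  fixes u v g B :: "complex \<Rightarrow> real"
  assumes span: "\<And>z. \<exists>a b. z = a *\<^sub>R \<xi> + b *\<^sub>R \<eta>"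
    and B: "real_analytic B" and \<kappa>: "\<kappa> \<noteq> 0"
    and du: "\<And>z. u differentiable at z" and dv: "\<And>z. v differentiable at z"
    and pde1: "\<And>z. dirderiv \<xi> u z = dirderiv \<eta> v z"
    and pde2: "\<And>z. dirderiv \<eta> u z + dirderiv \<xi> v z = \<kappa> * B z"
    and pde3: "\<And>z. g z * (dirderiv \<xi> u z + dirderiv \<eta> v z)
        + u z * dirderiv \<xi> g z + v z * dirderiv \<eta> g z = 0"
    and uv: "\<And>z. u z * v z = 0"
    and u: "compact (range u)"
    and cont: "continuous_on UNIV (dirderiv \<xi> g)" "continuous_on UNIV (dirderiv \<eta> g)"
  shows "(\<forall>z. B z = 0) \<or> (\<forall>z. v z = 0) \<and> (\<forall>z. dirderiv \<xi> g z = 0)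
    \<or> (\<forall>z. u z = 0) \<and> (\<forall>z. dirderiv \<eta> g z = 0)"
proof -
  \<comment> \<open>The system is symmetric under exchanging \<open>(u, \<xi>)\<close> with
    \<open>(v, \<eta>)\<close>; these forms let each lemma be applied to both pairs.\<close>
  have pde1': "dirderiv \<eta> v z = dirderiv \<xi> u z" for z
    by (simp add: pde1)
  have pde2': "dirderiv \<xi> v z + dirderiv \<eta> u z = \<kappa> * B z" for z
    by (simp add: pde2 add.commute)
  have uv': "v z * u z = 0" for z
    using uv[of z] by (simp add: mult.commute)
  consider "\<forall>z. v z = 0" | "\<forall>z. u z = 0" | z1 z2 where "u z1 \<noteq> 0" "v z2 \<noteq> 0"
    by blast
  then show ?thesis
  proof cases
    case 1
    then have v: "v = (\<lambda>_. 0)" by auto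
    have "(\<forall>z. B z = 0) \<or> (\<forall>z. dirderiv \<xi> g z = 0)"
      using pde1 pde2 pde3 by (intro metric_translation_invariant[OF B \<kappa> du _ _ cont(1)])
        (simp_all add: v frechet_derivative_const)
    with 1 show ?thesis by blast
  next
    case 2
    then have u: "u = (\<lambda>_. 0)" by auto
    have "(\<forall>z. B z = 0) \<or> (\<forall>z. dirderiv \<eta> g z = 0)"
      using pde1' pde2 pde3 by (intro metric_translation_invariant[OF B \<kappa> dv _ _ cont(2)])
        (simp_all add: u frechet_derivative_const)
    with 2 show ?thesis by blast
  next
    case 3
    have "B (z + t *\<^sub>R \<xi>) = B z" "B (z + t *\<^sub>R \<eta>) = B z" for z t
      using field_translation_invariant[OF B \<kappa> du dv pde1 pde2 uv 3(1)]
        field_translation_invariant[OF B \<kappa> dv du pde1' pde2' uv' 3(2)] by blast+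
    then have "B w = B z" for w z
      using span[of "w - z"] by (metis add.assoc add.commute diff_add_cancel)
    moreover obtain z where "B z = 0"
      using field_vanishes_somewhere[OF \<kappa> u du dv pde2 uv 3(1)] by blast
    ultimately show ?thesis by metis
  qed
qed

subsection \<open>Smooth functions\<close>

lemma smooth_imp_differentiable:
  assumes "smooth f"
  shows "f differentiable at z"
proof -
  have "C_k (Suc 0) f"
    using assms unfolding smooth_def by blast
  then show ?thesis
    by (simp add: differentiable_on_def)
qed

lemma smooth_imp_continuous_frechet_derivative:
  assumes "smooth f"
  shows "continuous_on UNIV (\<lambda>z. frechet_derivative f (at z) v)"
proof -
  have "C_k (Suc 0) f"
    using assms unfolding smooth_def by blast
  then show ?thesis by simp
qed

lemma smooth_imp_continuous:
  assumes "smooth f"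
  shows "continuous_on UNIV f"
proof -
  have "C_k 0 f"
    using assms unfolding smooth_def by blast
  then show ?thesis by simp
qed

lemma C_k_bounded_linear:
  assumes L: "bounded_linear L" and "C_k k f"
  shows "C_k k (\<lambda>x. L (f x))"
  using assms(2)
proof (induction k arbitrary: f)
  case 0
  then show ?case
    by (simp add: bounded_linear.continuous_on[OF L])
next
  case (Suc k)
  have D: "((\<lambda>x. L (f x)) has_derivative (\<lambda>v. L (frechet_derivative f (at x) v))) (at x)" for x
    using Suc.prems by (intro bounded_linear.has_derivative[OF L])
      (simp add: differentiable_on_def flip: frechet_derivative_works)
  then have "frechet_derivative (\<lambda>x. L (f x)) (at x) v = L (frechet_derivative f (at x) v)" for x v
    by (metis frechet_derivative_at)
  moreover have "(\<lambda>x. L (f x)) differentiable_on UNIV"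
    using D unfolding differentiable_on_def differentiable_def by blast
  ultimately show ?case
    using Suc by simp
qed

lemma smooth_bounded_linear:
  assumes "bounded_linear L" "smooth f"
  shows "smooth (\<lambda>x. L (f x))"
  using assms C_k_bounded_linear unfolding smooth_def by blast

lemma smooth_const: "smooth (\<lambda>_. c)"
proof -
  have "C_k k (\<lambda>_. c)" for k
    by (induction k arbitrary: c) (simp_all add: frechet_derivative_const)
  then show ?thesis
    unfolding smooth_def by blast
qed

text \<open>Makes the derivative of \<open>u\<close> along \<open>\<eta>\<close> bounded, by
  compactness of its range.\<close>

lemma periodic_frechet_derivative:
  assumes "periodic \<Gamma> f" and "\<And>z. f differentiable at z"
  shows "periodic \<Gamma> (\<lambda>z. frechet_derivative f (at z) v)"
  unfolding periodic_def
proof (intro allI ballI)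
  fix z \<gamma> assume "\<gamma> \<in> \<Gamma>"
  then have "(\<lambda>z. f (z + \<gamma>)) = f"
    using assms(1) by (auto simp: periodic_def)
  then show "frechet_derivative f (at (z + \<gamma>)) v = frechet_derivative f (at z) v"
    using frechet_derivative_translate[where z = z and t = \<gamma>, OF assms(2)] by simp
qed

text \<open>The derivative is complex-linear, so \<open>f\<close> is entire and Liouville's theorem
  applies.\<close>

lemma dzbar_eq_0_imp_constant:
  assumes "\<And>z. f differentiable at z" "\<And>z. dzbar f z = 0" and "bounded (range f)"
  obtains c where "\<And>z. f z = c"
proof -
  have "(f has_field_derivative dz f z) (at z)" for z
    using has_derivative_wirtinger[OF assms(1), of z] assms(2)[of z]
    by (simp add: has_field_derivative_def)
  then have "f holomorphic_on UNIV"
    by (auto simp: holomorphic_on_def field_differentiable_def)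
  from Liouville_theorem[OF this assms(3)] show thesis
    using that unfolding constant_on_def by blast
qed

lemma dirderiv_eq_dz:
  assumes "f differentiable at z"
  shows "dirderiv v f z = 2 * Re (v * dz (\<lambda>z. of_real (f z)) z)"
proof -
  let ?f = "\<lambda>z. complex_of_real (f z)"
  have "(?f has_derivative (\<lambda>v. of_real (dirderiv v f z))) (at z)"
    using assms by (intro bounded_linear.has_derivative[OF bounded_linear_of_real])
      (simp flip: frechet_derivative_works)
  moreover have "(?f has_derivative (\<lambda>h. dz ?f z * h + dzbar ?f z * cnj h)) (at z)"
    by (intro has_derivative_wirtinger differentiable_of_real assms)
  ultimately have "complex_of_real (dirderiv v f z) = dz ?f z * v + dzbar ?f z * cnj v"
    using has_derivative_unique by metis
  also have "dzbar ?f z = cnj (dz ?f z)"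
    using wirtinger_of_real[OF assms] by simp
  finally show ?thesis
    by (metis Re_complex_of_real complex_cnj_mult complex_add_cnj mult.commute)
qed

text \<open>Turns the complex equations for \<open>w\<close> into real ones for its real and
  imaginary parts.\<close>

lemma wirtinger_Re_Im:
  assumes "f differentiable at z"
  shows "dz f z = dz (\<lambda>z. of_real (Re (f z))) z + \<i> * dz (\<lambda>z. of_real (Im (f z))) z"
    and "dzbar f z = dzbar (\<lambda>z. of_real (Re (f z))) z + \<i> * dzbar (\<lambda>z. of_real (Im (f z))) z"
proof -
  let ?u = "\<lambda>z. complex_of_real (Re (f z))" and ?v = "\<lambda>z. complex_of_real (Im (f z))"
  have "?u differentiable at z" "?v differentiable at z"
    by (intro differentiable_of_real differentiable_bounded_linear[OF bounded_linear_Re]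
        differentiable_bounded_linear[OF bounded_linear_Im] assms)+
  note this[THEN has_derivative_wirtinger]
  then have "((\<lambda>z. ?u z + \<i> * ?v z) has_derivative (\<lambda>h. dz ?u z * h + dzbar ?u z * cnj h
      + \<i> * (dz ?v z * h + dzbar ?v z * cnj h))) (at z)"
    by (intro has_derivative_add has_derivative_mult_right)
  moreover have "(\<lambda>z. ?u z + \<i> * ?v z) = f"
    by (simp add: fun_eq_iff flip: complex_eq)
  moreover have "(\<lambda>h. dz ?u z * h + dzbar ?u z * cnj h + \<i> * (dz ?v z * h + dzbar ?v z * cnj h))
      = (\<lambda>h. (dz ?u z + \<i> * dz ?v z) * h + (dzbar ?u z + \<i> * dzbar ?v z) * cnj h)"
    by (simp add: fun_eq_iff algebra_simps)
  ultimately have "(f has_derivative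
      (\<lambda>h. (dz ?u z + \<i> * dz ?v z) * h + (dzbar ?u z + \<i> * dzbar ?v z) * cnj h)) (at z)"
    by simp
  from wirtinger_unique[OF this]
  show "dz f z = dz ?u z + \<i> * dz ?v z" "dzbar f z = dzbar ?u z + \<i> * dzbar ?v z" .
qed

lemma dzbar_of_real_mult:
  assumes "f differentiable at z"
  shows "dzbar (\<lambda>z. of_real (r * f z)) z = r * dzbar (\<lambda>z. of_real (f z)) z"
proof -
  let ?f = "\<lambda>z. complex_of_real (f z)"
  have "((\<lambda>z. of_real r * ?f z) has_derivative
      (\<lambda>h. of_real r * dz ?f z * h + of_real r * dzbar ?f z * cnj h)) (at z)"
    by (rule has_derivative_eq_rhs[OF has_derivative_mult_right[OF
          has_derivative_wirtinger[OF differentiable_of_real[OF assms]]]])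
      (simp add: fun_eq_iff algebra_simps)
  from wirtinger_unique(2)[OF this] show ?thesis by simp
qed

section \<open>From the coefficient equations on the torus to the two alternatives\<close>

theorem theorem2:
  fixes \<Gamma> :: "complex set"
    and g B a\<^sub>0\<^sub>1 a\<^sub>0\<^sub>2 :: "complex \<Rightarrow> real"
    and a\<^sub>1 a\<^sub>2 :: "complex \<Rightarrow> complex"
    and E\<^sub>1 E\<^sub>2 :: real
  assumes "is_lattice \<Gamma>"
    and "smooth_on_torus \<Gamma> g" and "\<And>z. g z > 0"
    and "periodic \<Gamma> B" and "real_analytic B"
    and "smooth_on_torus \<Gamma> a\<^sub>2" and "\<exists>z. a\<^sub>2 z \<noteq> 0"
    and "smooth_on_torus \<Gamma> a\<^sub>1"
    and "smooth_on_torus \<Gamma> a\<^sub>0\<^sub>1" and "smooth_on_torus \<Gamma> a\<^sub>0\<^sub>2"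
    and "E\<^sub>1 > 0" and "E\<^sub>2 > 0" and "E\<^sub>1 \<noteq> E\<^sub>2"
    and "first_integral_on_level g B E\<^sub>1 (quadratic_fn g a\<^sub>2 a\<^sub>1 a\<^sub>0\<^sub>1 a\<^sub>0\<^sub>2)"
    and "first_integral_on_level g B E\<^sub>2 (quadratic_fn g a\<^sub>2 a\<^sub>1 a\<^sub>0\<^sub>1 a\<^sub>0\<^sub>2)"
  shows "(\<forall>z. B z = 0) \<or> admits_linear_integral \<Gamma> g B"
proof -
  have smooth: "smooth g" "smooth a\<^sub>2" "smooth a\<^sub>1" "smooth a\<^sub>0\<^sub>1" "smooth a\<^sub>0\<^sub>2"
    and per: "periodic \<Gamma> g" "periodic \<Gamma> a\<^sub>2" "periodic \<Gamma> a\<^sub>1" "periodic \<Gamma> a\<^sub>0\<^sub>1"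
    using assms(2,6,8,9,10) by (simp_all add: smooth_on_torus_def)
  have diff: "g differentiable at z" "a\<^sub>0\<^sub>1 differentiable at z" "a\<^sub>0\<^sub>2 differentiable at z"
      "a\<^sub>1 differentiable at z" "a\<^sub>2 differentiable at z" for z
    by (intro smooth_imp_differentiable smooth)+
  have compact_range: "compact (range f)" if "smooth f" "periodic \<Gamma> f"
    for f :: "complex \<Rightarrow> 'b::real_normed_vector"
    using periodic_range_compact[OF assms(1)] smooth_imp_continuous that by blast
  define gz where "gz = dz (\<lambda>z. of_real (g z))"
  note level1 = quadratic_integral_on_level[OF diff assms(3) assms(11) assms(14)]
  note level2 = quadratic_integral_on_level[OF diff assms(3) assms(12) assms(15)]
  have e1: "dzbar a\<^sub>1 z = - 2 * \<i> * B z * a\<^sub>2 z" for z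
    using level1(2)[of z] by (simp add: eq_neg_iff_add_eq_0)
  have e0: "dzbar (\<lambda>z. of_real (a\<^sub>0\<^sub>1 z)) z = - \<i> * B z * a\<^sub>1 z" for z
    using two_levels_eq_0[OF level1(3)[of z] level2(3)[of z] assms(13)]
    by (simp add: eq_neg_iff_add_eq_0)
  have eg: "Re (dz a\<^sub>1 z + a\<^sub>1 z * gz z / g z) = 0" for z
    unfolding gz_def by (rule level1(4))
  obtain c where c: "\<And>z. a\<^sub>2 z = c"
    using dzbar_eq_0_imp_constant[OF diff(5) level1(1)] compact_imp_bounded[OF compact_range] smooth per
    by metis
  \<comment> \<open>Dividing \<open>a\<^sub>1\<close> by a root of \<open>a\<^sub>2\<close>
    normalises the quadratic part, and the direction of this root becomes the first coordinate
    axis.\<close>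
  define s where "s = csqrt c"
  have s: "s * s = c" "s \<noteq> 0"
    using assms(7) c by (auto simp: s_def simp flip: power2_eq_square)
  define w where "w = (\<lambda>z. a\<^sub>1 z / s)"
  have w: "smooth w" "periodic \<Gamma> w"
    using smooth_bounded_linear[OF bounded_linear_divide smooth(3)] per(3)
    by (simp_all add: w_def periodic_def)
  have dw: "w differentiable at z" for z
    by (rule smooth_imp_differentiable[OF w(1)])
  have "(w has_derivative (\<lambda>h. dz a\<^sub>1 z / s * h + dzbar a\<^sub>1 z / s * cnj h)) (at z)" for z
    using bounded_linear.has_derivative[OF bounded_linear_divide[of s] has_derivative_wirtinger[OF diff(4)[of z]]]
    by (simp add: w_def add_divide_distrib)
  note wirtinger_unique[OF this]
  then have dz_w: "dz a\<^sub>1 z = s * dz w z" and dzbar_w: "dzbar w z = - 2 * \<i> * B z * s" for z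
    using s(2) by (simp_all add: e1 c flip: s(1))
  define u v where "u = (\<lambda>z. Re (w z))" and "v = (\<lambda>z. Im (w z))"
  have uv: "smooth u" "periodic \<Gamma> u" "smooth v" "periodic \<Gamma> v"
    using smooth_bounded_linear[OF bounded_linear_Re w(1)] smooth_bounded_linear[OF bounded_linear_Im w(1)] w(2)
    by (simp_all add: u_def v_def periodic_def)
  have du: "u differentiable at z" and dv: "v differentiable at z" for z
    by (intro smooth_imp_differentiable uv)+
  have a1: "a\<^sub>1 z = s * (of_real (u z) + \<i> * of_real (v z))" for z
    using s by (simp add: u_def v_def w_def complex_eq[symmetric])

  \<comment> \<open>This is the discriminant
    \<open>a\<^sub>1^2 - 4 * a\<^sub>2 * a\<^sub>0\<^sub>1\<close> divided by
    \<open>a\<^sub>2\<close>. In its derivative by \<open>dzbar\<close> the two terms containing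
    \<open>B\<close> cancel.\<close>
  define f where "f = (\<lambda>z. w z * w z - 4 * of_real (a\<^sub>0\<^sub>1 z))"
  have Df: "(f has_derivative (\<lambda>h. (2 * w z * dz w z - 4 * dz (\<lambda>z. of_real (a\<^sub>0\<^sub>1 z)) z) * h
      + (2 * w z * dzbar w z - 4 * dzbar (\<lambda>z. of_real (a\<^sub>0\<^sub>1 z)) z) * cnj h)) (at z)" for z
  proof -
    note D = has_derivative_wirtinger[OF dw] has_derivative_wirtinger[OF differentiable_of_real[OF diff(2)]]
    show ?thesis
      unfolding f_def
      by (rule has_derivative_eq_rhs[OF has_derivative_diff[OF has_derivative_mult[OF D(1) D(1)]
            has_derivative_mult_right[OF D(2)]]])
        (simp add: fun_eq_iff algebra_simps)
  qed
  have "dzbar f z = 0" for z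
    using wirtinger_unique(2)[OF Df] dzbar_w[of z] e0[of z] s by (simp add: w_def)
  moreover have "f differentiable at z" for z
    using Df differentiable_def by blast
  moreover have "bounded (range f)"
  proof (rule compact_imp_bounded[OF periodic_range_compact[OF assms(1)]])
    show "periodic \<Gamma> f"
      using w(2) per(4) by (simp add: f_def periodic_def)
    show "continuous_on UNIV f"
      using \<open>\<And>z. f differentiable at z\<close>
      by (simp add: continuous_at_imp_continuous_on differentiable_imp_continuous_within)
  qed
  ultimately obtain k where "\<And>z. f z = k"
    using dzbar_eq_0_imp_constant by metis
  \<comment> \<open>As \<open>a\<^sub>0\<^sub>1\<close> is real, the imaginary part of
    \<open>f\<close> is \<open>2 * u * v\<close>.\<close>
  then have "Im (f z) = Im k" for z by simp
  then have prod: "u z * v z = Im k / 2" for z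
    by (simp add: f_def u_def v_def field_simps)

  let ?\<eta> = "\<i> * s"
  define \<kappa> where "\<kappa> = - 4 * (cmod s)\<^sup>2"
  have "\<kappa> \<noteq> 0"
    using s by (simp add: \<kappa>_def)
  have span: "\<exists>a b. z = a *\<^sub>R s + b *\<^sub>R ?\<eta>" for z
  proof (intro exI)
    have "z = (of_real (Re (z / s)) + \<i> * of_real (Im (z / s))) * s"
      using s by (simp add: complex_eq[symmetric])
    then show "z = Re (z / s) *\<^sub>R s + Im (z / s) *\<^sub>R ?\<eta>"
      by (simp add: scaleR_conv_of_real algebra_simps)
  qed
  \<comment> \<open>Up to the factor 2 and a sign, real and imaginary parts of these are the
    derivatives along \<open>s\<close> and along the perpendicular direction.\<close>
  define P Q where "P = (\<lambda>z. s * dz (\<lambda>z. of_real (u z)) z)" and "Q = (\<lambda>z. s * dz (\<lambda>z. of_real (v z)) z)"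
  have dirs: "dirderiv s u z = 2 * Re (P z)" "dirderiv ?\<eta> u z = - 2 * Im (P z)"
      "dirderiv s v z = 2 * Re (Q z)" "dirderiv ?\<eta> v z = - 2 * Im (Q z)"
      "dirderiv s g z = 2 * Re (s * gz z)" "dirderiv ?\<eta> g z = - 2 * Im (s * gz z)" for z
    by (simp_all add: dirderiv_eq_dz du dv diff(1) P_def Q_def gz_def algebra_simps)
  \<comment> \<open>Multiplication by \<open>cnj s\<close> makes the right-hand side purely
    imaginary, so the real part is free of \<open>B\<close> and gives \<open>pde1\<close>.\<close>
  have "cnj (P z) + \<i> * cnj (Q z) = cnj s * dzbar w z" for z
    using wirtinger_Re_Im(2)[OF dw, of z] wirtinger_of_real[OF du, of z] wirtinger_of_real[OF dv, of z]
    by (simp add: P_def Q_def u_def v_def algebra_simps)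
  then have "cnj (P z) + \<i> * cnj (Q z) = of_real (- 2 * B z * (cmod s)\<^sup>2) * \<i>" for z
    unfolding dzbar_w using complex_norm_square[of s] by (simp add: mult_ac)
  then have PQ: "Re (P z) + Im (Q z) = 0" "- Im (P z) + Re (Q z) = - 2 * B z * (cmod s)\<^sup>2" for z
    by (simp_all add: complex_eq_iff del: of_real_mult)
  have pde1: "dirderiv s u z = dirderiv ?\<eta> v z"
    and pde2: "dirderiv ?\<eta> u z + dirderiv s v z = \<kappa> * B z" for z
    unfolding dirs \<kappa>_def using PQ(1)[of z] PQ(2)[of z] by (linarith, simp add: mult.commute)
  have "s * dz w z = P z + \<i> * Q z" for z
    using wirtinger_Re_Im(1)[OF dw, of z] by (simp add: P_def Q_def u_def v_def algebra_simps)
  \<comment> \<open>Multiplying \<open>eg\<close> by \<open>g\<close> gives the real part of the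
    \<open>dz\<close> derivative of \<open>g * a\<^sub>1\<close>, half a divergence in the
    directions \<open>s\<close> and \<open>\<i> * s\<close>.\<close>
  have pde3: "g z * (dirderiv s u z + dirderiv ?\<eta> v z)
      + u z * dirderiv s g z + v z * dirderiv ?\<eta> g z = 0" for z
  proof -
    have "Re (of_real (g z) * (dz a\<^sub>1 z + a\<^sub>1 z * gz z / g z)) = 0"
      using eg[of z] by (simp only: Re_of_real_mult mult_zero_right)
    also have "of_real (g z) * (dz a\<^sub>1 z + a\<^sub>1 z * gz z / g z)
        = of_real (g z) * (P z + \<i> * Q z) + (of_real (u z) + \<i> * of_real (v z)) * (s * gz z)"
      using assms(3)[of z] \<open>s * dz w z = _\<close> by (simp add: dz_w a1 field_simps)
    finally show ?thesis
      by (simp add: dirs algebra_simps)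
  qed
  have cont: "continuous_on UNIV (dirderiv d g)" for d
    by (rule smooth_imp_continuous_frechet_derivative[OF smooth(1)])

  show ?thesis
  proof (cases "Im k = 0")
    case False
    obtain K1 where K1: "\<And>z. \<bar>u z\<bar> \<le> K1"
      using compact_imp_bounded[OF compact_range[OF uv(1,2)]] by (auto simp: bounded_iff)
    obtain K2 where K2: "\<And>z. \<bar>v z\<bar> \<le> K2"
      using compact_imp_bounded[OF compact_range[OF uv(3,4)]] by (auto simp: bounded_iff)
    have "compact (range (dirderiv ?\<eta> u))"
      by (intro periodic_range_compact[OF assms(1)] periodic_frechet_derivative uv(2) du
          smooth_imp_continuous_frechet_derivative uv(1))
    then obtain L where L: "\<And>z. \<bar>dirderiv ?\<eta> u z\<bar> \<le> L"
      using compact_imp_bounded by (force simp: bounded_iff)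
    have "dirderiv d u z = 0" "dirderiv d v z = 0" for d z
      using product_constant_imp_dirderiv_0[OF span du dv pde1 prod, of "max K1 K2" L] False K1 K2 L
      by (simp_all add: le_max_iff_disj)
    then show ?thesis
      using pde2 \<open>\<kappa> \<noteq> 0\<close> by simp
  next
    case True
    have linear: ?thesis
      if "a \<noteq> 0" "smooth b" "periodic \<Gamma> b"
        "\<And>z. dzbar (\<lambda>z. of_real (b z)) z = - \<i> * B z * a" "\<And>z. dirderiv a g z = 0" for a b
    proof -
      have "first_integral g B (linear_fn (\<lambda>_. a) b)"
        using that(4,5) smooth_imp_differentiable[OF that(2)]
        by (intro first_integral_linear_const diff assms(3)) (simp_all add: dirderiv_eq_dz[OF diff(1)])
      moreover have "smooth_on_torus \<Gamma> (\<lambda>_. a)"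
        by (simp add: smooth_on_torus_def smooth_const periodic_def)
      ultimately show ?thesis
        unfolding admits_linear_integral_def smooth_on_torus_def using that(1-3) by blast
    qed
    have scaled: "smooth (\<lambda>z. r * f z)" "periodic \<Gamma> (\<lambda>z. r * f z)"
        "dzbar (\<lambda>z. of_real (r * f z)) z = r * dzbar (\<lambda>z. of_real (f z)) z"
      if "smooth f" "periodic \<Gamma> f" for r and f :: "complex \<Rightarrow> real" and z
    proof -
      show "smooth (\<lambda>z. r * f z)"
        by (rule smooth_bounded_linear[OF bounded_linear_mult_right that(1)])
      show "periodic \<Gamma> (\<lambda>z. r * f z)"
        using that(2) by (simp add: periodic_def)
      show "dzbar (\<lambda>z. of_real (r * f z)) z = r * dzbar (\<lambda>z. of_real (f z)) z"
        by (rule dzbar_of_real_mult[OF smooth_imp_differentiable[OF that(1)]])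
    qed
    have "(\<forall>z. B z = 0) \<or> (\<forall>z. v z = 0) \<and> (\<forall>z. dirderiv s g z = 0)
        \<or> (\<forall>z. u z = 0) \<and> (\<forall>z. dirderiv ?\<eta> g z = 0)"
      using prod True
      by (intro product_zero_dichotomy[OF span assms(5) \<open>\<kappa> \<noteq> 0\<close> du dv pde1 pde2 pde3 _ compact_range[OF uv(1,2)] cont cont]) simp
    then show ?thesis
    proof (elim disjE conjE)
      assume "\<forall>z. B z = 0"
      then show ?thesis by blast
    next
      assume "\<forall>z. v z = 0" and g: "\<forall>z. dirderiv s g z = 0"
      then have "w = (\<lambda>z. of_real (u z))"
        by (simp add: fun_eq_iff complex_eq_iff u_def v_def)
      \<comment> \<open>With \<open>a = s\<close>, the linear integral needs
        \<open>b = u / 2\<close>, since \<open>dzbar w\<close> is twice the required value.\<close>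
      then have "dzbar (\<lambda>z. of_real (1 / 2 * u z)) z = - \<i> * B z * s" for z
        using scaled(3)[OF uv(1,2), of "1 / 2" z] dzbar_w[of z] by simp
      then show ?thesis
        using linear[OF s(2) scaled(1,2)[OF uv(1,2)]] g by blast
    next
      assume "\<forall>z. u z = 0" and g: "\<forall>z. dirderiv ?\<eta> g z = 0"
      then have "u = (\<lambda>_. 0)" by auto
      then have "dzbar w z = \<i> * dzbar (\<lambda>z. of_real (v z)) z" for z
        using wirtinger_Re_Im(2)[OF dw, of z] wirtinger_unique(2)[of "\<lambda>_. 0" 0 0 z]
        by (simp add: u_def v_def fun_eq_iff)
      then have "\<i> * dzbar (\<lambda>z. of_real (v z)) z = \<i> * (- 2 * B z * s)" for z
        using dzbar_w[of z] by (simp add: mult_ac)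
      then have "dzbar (\<lambda>z. of_real (v z)) z = - 2 * B z * s" for z
        by (metis complex_i_not_zero mult_cancel_left)
      \<comment> \<open>For \<open>a = \<i> * s\<close> the required value is \<open>B * s\<close>,
        which gives \<open>b = - v / 2\<close>.\<close>
      then have "dzbar (\<lambda>z. of_real (- 1 / 2 * v z)) z = - \<i> * B z * ?\<eta>" for z
        using scaled(3)[OF uv(3,4), of "- 1 / 2" z] by (simp add: mult_ac)
      moreover have "?\<eta> \<noteq> 0"
        using s(2) by simp
      ultimately show ?thesis
        using linear[OF _ scaled(1,2)[OF uv(3,4)]] g by blast
    qed
  qed
qed

end
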